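(* Let $\Omega\subset\mathbb{R}^n$ be a bounded domain. Then there exists $C>0$ such that, for all nontrivial finite (positive) Radon measures $\mu_0$ in $\Omega$ such that $d_{\hat\Omega}\in L^1(\mu_0)$, one can find a measurable weight $w_0$ in $\Omega$ with the following properties: (A) $w_0\in L^1(\Omega)$ and $w_0(x)>0$ for almost every $x\in\Omega$; (B) for any finite signed Radon measure $\mu$ in $\Omega$ satisfying $\mu(\Omega)=0$ and $|\mu|\le\kappa\mu_0$ for some real number $\kappa>0$, there exists a (measurable) vector-valued function $u:\Omega\to\mathbb{R}^n$ satisfying $$|u(x)|\le C\kappa|w_0(x)|\quad\text{for a.e. }x\in\Omega$$ and solving $\operatorname{div}u=\mu$ in $\Omega$, $u\cdot\nu=0$ on $\partial\Omega$, in the sense that $$\int_\Omega u\cdot\nabla\varphi=-\int_\Omega\varphi\,d\mu$$ for any $\varphi\in\mathcal{D}(\mathbb{R}^n)$.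
   Context: $n\ge1$ is an integer; $m$ is Lebesgue measure on $\mathbb{R}^n$. "Domain" means open connected set. When no measure is specified, "almost every" and $L^p$ spaces refer to Lebesgue measure. $\mathcal{D}(\mathbb{R}^n)$ is the set of all $C^\infty$ functions on $\mathbb{R}^n$ with compact support (they may be nonzero on and around $\partial\Omega$). Given the bounded domain $\Omega$, a measurable cover $\tilde\Omega$ of $\Omega$ is chosen once and for all: a measurable set $\tilde\Omega\supseteq\Omega$ with $m(\tilde\Omega\setminus\Omega)=0$. Put $\hat\Omega:=\{x\in\tilde\Omega: d(x,\mathbb{R}^n\setminus\tilde\Omega)>0\}$, where $d(\cdot,\cdot)$ is Euclidean distance; $\hat\Omega$ is open and connected, and $\Omega\subseteq\hat\Omega\subseteq\tilde\Omega$. A point $x_0\in\Omega$ is fixed, and for $x\in\hat\Omega$, $d_{\hat\Omega}(x)$ is the infimum of the lengths of all rectifiable curves joining $x$ to $x_0$ in $\hat\Omega$. (The condition $d_{\hat\Omega}\in L^1(\mu_0)$ does not depend on the choice of $x_0$.) *)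

theory Defs
  imports "HOL-Analysis.Analysis"
begin

text \<open>The set of points of the measurable cover lying at positive distance from its complement.
  The convention \<open>infdist x {} = 0\<close> is never met: a measurable cover of a bounded set has
  finite measure, so its complement is nonempty.\<close>

definition cover_core :: "(real ^ 'n) set \<Rightarrow> (real ^ 'n) set" where
  "cover_core T = {x \<in> T. infdist x (- T) > 0}"


definition path_length :: "(real \<Rightarrow> real ^ 'n) \<Rightarrow> ennreal" where
  "path_length g =
     (SUP (k, t) \<in> {(k :: nat, t :: nat \<Rightarrow> real).
                     t 0 = 0 \<and> t k = 1 \<and> (\<forall>i<k. t i \<le> t (Suc i))}.
        ennreal (\<Sum>i<k. dist (g (t i)) (g (t (Suc i)))))"

definition rectifiable_path :: "(real \<Rightarrow> real ^ 'n) \<Rightarrow> bool" where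
  "rectifiable_path g \<longleftrightarrow> path g \<and> path_length g < \<infinity>"

text \<open>The infimum is a real one; on an open connected \<open>S\<close> the set is nonempty for all
  \<open>x0, x \<in> S\<close>.\<close>

definition inner_dist :: "(real ^ 'n) set \<Rightarrow> real ^ 'n \<Rightarrow> real ^ 'n \<Rightarrow> real" where
  "inner_dist S x0 x =
     Inf {enn2real (path_length g) | g.
            rectifiable_path g \<and> path_image g \<subseteq> S \<and> pathstart g = x \<and> pathfinish g = x0}"


abbreviation borel_in :: "(real ^ 'n) set \<Rightarrow> (real ^ 'n) set set" where
  "borel_in \<Omega> \<equiv> sets (restrict_space borel \<Omega>)"

definition radon_measure_in :: "(real ^ 'n) set \<Rightarrow> (real ^ 'n) measure \<Rightarrow> bool" where
  "radon_measure_in \<Omega> M \<longleftrightarrow>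
     sets M = borel_in \<Omega> \<and>
     (\<forall>K. compact K \<and> K \<subseteq> \<Omega> \<longrightarrow> emeasure M K < \<infinity>) \<and>
     (\<forall>A \<in> borel_in \<Omega>. emeasure M A = (SUP K \<in> {K. compact K \<and> K \<subseteq> A}. emeasure M K))"

text \<open>A finite signed measure in \<open>\<Omega>\<close> is a real-valued countably additive set function on the
  Borel subsets of \<open>\<Omega>\<close>; its values on all other sets are irrelevant.\<close>

definition finite_signed_measure_in :: "(real ^ 'n) set \<Rightarrow> ((real ^ 'n) set \<Rightarrow> real) \<Rightarrow> bool" where
  "finite_signed_measure_in \<Omega> \<mu> \<longleftrightarrow>
     (\<forall>E :: nat \<Rightarrow> (real ^ 'n) set.
        range E \<subseteq> borel_in \<Omega> \<and> disjoint_family E \<longrightarrow> (\<lambda>i. \<mu> (E i)) sums \<mu> (\<Union>i. E i))"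

definition total_variation ::
    "(real ^ 'n) set \<Rightarrow> ((real ^ 'n) set \<Rightarrow> real) \<Rightarrow> (real ^ 'n) set \<Rightarrow> ennreal" where
  "total_variation \<Omega> \<mu> A =
     (SUP E \<in> {E :: nat \<Rightarrow> (real ^ 'n) set.
                range E \<subseteq> borel_in \<Omega> \<and> disjoint_family E \<and> (\<Union>i. E i) = A}.
        \<Sum>i. ennreal \<bar>\<mu> (E i)\<bar>)"

definition variation_measure ::
    "(real ^ 'n) set \<Rightarrow> ((real ^ 'n) set \<Rightarrow> real) \<Rightarrow> (real ^ 'n) measure" where
  "variation_measure \<Omega> \<mu> = measure_of \<Omega> (borel_in \<Omega>) (total_variation \<Omega> \<mu>)"

definition finite_signed_radon_measure_in ::
    "(real ^ 'n) set \<Rightarrow> ((real ^ 'n) set \<Rightarrow> real) \<Rightarrow> bool" where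
  "finite_signed_radon_measure_in \<Omega> \<mu> \<longleftrightarrow>
     finite_signed_measure_in \<Omega> \<mu> \<and> radon_measure_in \<Omega> (variation_measure \<Omega> \<mu>)"

text \<open>The Jordan decomposition \<open>\<mu> = \<mu>\<^sup>+ - \<mu>\<^sup>-\<close> with \<open>\<mu>\<^sup>+ = (|\<mu>| + \<mu>) / 2\<close> and
  \<open>\<mu>\<^sup>- = (|\<mu>| - \<mu>) / 2\<close>; here \<open>|\<mu>|\<close> is finite because \<open>\<mu>\<close> is real-valued.\<close>

definition positive_part ::
    "(real ^ 'n) set \<Rightarrow> ((real ^ 'n) set \<Rightarrow> real) \<Rightarrow> (real ^ 'n) measure" where
  "positive_part \<Omega> \<mu> =
     measure_of \<Omega> (borel_in \<Omega>) (\<lambda>A. ennreal ((enn2real (total_variation \<Omega> \<mu> A) + \<mu> A) / 2))"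

definition negative_part ::
    "(real ^ 'n) set \<Rightarrow> ((real ^ 'n) set \<Rightarrow> real) \<Rightarrow> (real ^ 'n) measure" where
  "negative_part \<Omega> \<mu> =
     measure_of \<Omega> (borel_in \<Omega>) (\<lambda>A. ennreal ((enn2real (total_variation \<Omega> \<mu> A) - \<mu> A) / 2))"

definition signed_integral ::
    "(real ^ 'n) set \<Rightarrow> ((real ^ 'n) set \<Rightarrow> real) \<Rightarrow> (real ^ 'n \<Rightarrow> real) \<Rightarrow> real" where
  "signed_integral \<Omega> \<mu> \<phi> =
     (LINT x|positive_part \<Omega> \<mu>. \<phi> x) - (LINT x|negative_part \<Omega> \<mu>. \<phi> x)"


definition partial_deriv :: "'n \<Rightarrow> (real ^ 'n \<Rightarrow> real) \<Rightarrow> real ^ 'n \<Rightarrow> real" where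
  "partial_deriv i \<phi> x = frechet_derivative \<phi> (at x) (axis i 1)"

definition gradient :: "(real ^ 'n \<Rightarrow> real) \<Rightarrow> real ^ 'n \<Rightarrow> real ^ 'n" where
  "gradient \<phi> x = (\<chi> i. partial_deriv i \<phi> x)"

primrec k_times_cont_diff :: "nat \<Rightarrow> (real ^ 'n \<Rightarrow> real) \<Rightarrow> bool" where
  "k_times_cont_diff 0 \<phi> \<longleftrightarrow> continuous_on UNIV \<phi>"
| "k_times_cont_diff (Suc k) \<phi> \<longleftrightarrow>
     (\<forall>x. \<phi> differentiable (at x)) \<and> (\<forall>i. k_times_cont_diff k (partial_deriv i \<phi>))"

definition test_function :: "(real ^ 'n \<Rightarrow> real) \<Rightarrow> bool" where
  "test_function \<phi> \<longleftrightarrow> (\<forall>k. k_times_cont_diff k \<phi>) \<and> compact (closure {x. \<phi> x \<noteq> 0})"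

end

theory Submission
  imports Defs
begin

text \<open>
  Put \<open>S = cover_core \<Omega>t\<close>; it is open, contains \<open>\<Omega>\<close>, and \<open>S - \<Omega>\<close> is a null set. The idea is
  to transport mass. Each unit of mass at \<open>y \<in> \<Omega>\<close> is carried along a polygon in \<open>S\<close> to \<open>x0\<close>, and the
  momentum of this motion, accumulated over time, is a vector field with divergence
  \<open>\<delta>\<^sub>y\<close> minus the final distribution. As \<open>\<mu> \<Omega> = 0\<close>, the final distributions cancel when the fields are
  superposed with weights \<open>\<mu>\<close>.

  A field concentrated on a polygon is no function, so the particle is spread out while it moves: it
  gets a random offset \<open>z\<close> in the unit ball, and sits at \<open>p + r z\<close>, where the pair \<open>(p, r)\<close> moves
  linearly on every leg of the journey. It starts at \<open>(y, 0)\<close>; on the first leg the radius grows to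
  a positive value, it stays positive from then on, and the last legs bring the pair
  to \<open>(x0, \<epsilon>)\<close> with \<open>\<epsilon>\<close> independent of \<open>y\<close>.
  For a positive radius \<open>z \<mapsto> p + r z\<close> pulls null sets back to null sets; so the image of the
  whole motion is absolutely continuous, by Fubini, and a particle in \<open>S\<close> is almost surely in \<open>\<Omega>\<close>.
  The polygon is inscribed in a nearly shortest curve (\<open>inscribed_polygon\<close>), hence the distance covered is at most
  \<open>inner_dist S x0 y\<close> plus a constant, which is integrable. One polygon serves a whole small ball
  of starting points, and countably many balls cover \<open>\<Omega>\<close>; this makes the choice of the polygon
  measurable in \<open>y\<close> (\<open>fattened_polygons\<close>).

  Let \<open>Q\<close> be the product of \<open>\<mu>0\<close>, the counting measure on the legs, and the laws of the time and the
  offset, and let \<open>X\<close> and \<open>V\<close> be position and velocity. The weight is the Lebesgue density of the image under \<open>X\<close> of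
  \<open>|V| Q\<close>. Given \<open>\<mu> = h \<mu>0\<close> with \<open>|h| \<le> \<kappa>\<close> (\<open>signed_measure_density\<close>), the \<open>i\<close>-th component of \<open>u\<close> is the
  density of the image of \<open>h V\<^sub>i Q\<close>, which is dominated by \<open>\<kappa>\<close> times the former image
  (\<open>pushforward_multiplier\<close>); so \<open>C\<close> is just the dimension. The divergence equation is the fundamental theorem of calculus
  on each leg, summed along the journey (\<open>integral_gradient_section\<close>). Adding \<open>1\<close> makes the weight
  positive.
\<close>

section \<open>Total variation and the Jordan decomposition\<close>

lemma sigma_algebra_borel_in:
  fixes \<Omega> :: "(real ^ 'n) set"
  shows "sigma_algebra \<Omega> (borel_in \<Omega>)"
  using sets.sigma_algebra_axioms[of "restrict_space borel \<Omega>"] by (simp add: space_restrict_space)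

lemma signed_measure_empty:
  assumes "finite_signed_measure_in \<Omega> \<mu>"
  shows "\<mu> {} = 0"
proof -
  have "(\<lambda>i::nat. \<mu> {}) sums \<mu> (\<Union>i::nat. {})"
    using assms unfolding finite_signed_measure_in_def
    by (elim allE[where x="\<lambda>_. {}"]) (auto simp: disjoint_family_on_def)
  then have "(\<lambda>i::nat. \<mu> {}) \<longlonglongrightarrow> 0"
    using sums_summable summable_LIMSEQ_zero by blast
  then show ?thesis
    by (simp add: LIMSEQ_const_iff)
qed

lemma ennreal_abs_le_suminf:
  fixes f :: "nat \<Rightarrow> real"
  assumes "f sums s"
  shows "ennreal \<bar>s\<bar> \<le> (\<Sum>i. ennreal \<bar>f i\<bar>)"
proof (cases "(\<Sum>i. ennreal \<bar>f i\<bar>) = top")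
  case False
  then have sm: "summable (\<lambda>i. \<bar>f i\<bar>)"
    by (intro summable_suminf_not_top) auto
  have "\<bar>s\<bar> \<le> (\<Sum>i. \<bar>f i\<bar>)"
    using summable_rabs[OF sm] assms by (simp add: sums_iff)
  then show ?thesis
    using suminf_ennreal2[OF _ sm] by (simp only: ennreal_leI abs_ge_zero)
qed simp

lemma signed_measure_abs_le_total_variation:
  assumes mu: "finite_signed_measure_in \<Omega> \<mu>" and A: "A \<in> borel_in \<Omega>"
  shows "ennreal \<bar>\<mu> A\<bar> \<le> total_variation \<Omega> \<mu> A"
proof -
  let ?E = "\<lambda>i::nat. if i = 0 then A else {}"
  have "ennreal \<bar>\<mu> A\<bar> = (\<Sum>i. ennreal \<bar>\<mu> (?E i)\<bar>)"
    using signed_measure_empty[OF mu] by (subst suminf_finite[of "{0}"]) auto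
  also have "\<dots> \<le> total_variation \<Omega> \<mu> A"
    unfolding total_variation_def using A
    by (intro SUP_upper) (auto simp: disjoint_family_on_def split: if_splits)
  finally show ?thesis .
qed

lemma total_variation_empty:
  assumes mu: "finite_signed_measure_in \<Omega> \<mu>"
  shows "total_variation \<Omega> \<mu> {} = 0"
proof -
  have "(\<Sum>i. ennreal \<bar>\<mu> (E i)\<bar>) \<le> 0" if "(\<Union>i. E i) = {}" for E :: "nat \<Rightarrow> _"
  proof -
    have "E i = {}" for i using that by auto
    then show ?thesis using signed_measure_empty[OF mu] by simp
  qed
  then have "total_variation \<Omega> \<mu> {} \<le> 0"
    unfolding total_variation_def by (intro SUP_least) blast
  then show ?thesis by simp
qed

text \<open>Interleaving a partition of \<open>A\<close> with a partition of \<open>B\<close> gives a partition of the union, so the two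
  suprema can be taken independently.\<close>

lemma total_variation_superadditive:
  assumes mu: "finite_signed_measure_in \<Omega> \<mu>"
    and A: "A \<in> borel_in \<Omega>" and B: "B \<in> borel_in \<Omega>" and AB: "A \<inter> B = {}"
  shows "total_variation \<Omega> \<mu> A + total_variation \<Omega> \<mu> B \<le> total_variation \<Omega> \<mu> (A \<union> B)"
proof -
  define part where "part A = {E :: nat \<Rightarrow> _. range E \<subseteq> borel_in \<Omega> \<and> disjoint_family E \<and> (\<Union>i. E i) = A}" for A
  define v where "v E = (\<Sum>i. ennreal \<bar>\<mu> (E i)\<bar>)" for E :: "nat \<Rightarrow> _"
  have TV: "total_variation \<Omega> \<mu> A = (SUP E\<in>part A. v E)" for A
    by (simp add: total_variation_def part_def v_def)
  have ne: "part A \<noteq> {}" if "A \<in> borel_in \<Omega>" for A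
  proof -
    have "(\<lambda>i::nat. if i = 0 then A else {}) \<in> part A"
      unfolding part_def using that by (auto simp: disjoint_family_on_def split: if_splits)
    then show ?thesis by auto
  qed
  have step: "v E + v F \<le> total_variation \<Omega> \<mu> (A \<union> B)" if E: "E \<in> part A" and F: "F \<in> part B" for E F
  proof -
    define G where "G i = (if even i then E (i div 2) else F (i div 2))" for i :: nat
    have sub: "E i \<subseteq> A" "F i \<subseteq> B" for i using E F by (auto simp: part_def)
    have Gp: "G \<in> part (A \<union> B)"
      unfolding part_def
    proof (intro CollectI conjI)
      show "range G \<subseteq> borel_in \<Omega>" using E F by (auto simp: part_def G_def)
      show "disjoint_family G"
        unfolding disjoint_family_on_def
      proof (intro ballI impI)
        fix i j :: nat assume "i \<noteq> j"
        then have "even i = even j \<Longrightarrow> i div 2 \<noteq> j div 2"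
          by (metis even_two_times_div_two odd_two_times_div_two_succ)
        then show "G i \<inter> G j = {}"
          using E F AB sub(1)[of "i div 2"] sub(2)[of "i div 2"] sub(1)[of "j div 2"] sub(2)[of "j div 2"]
          unfolding G_def part_def disjoint_family_on_def
          by (cases "even i"; cases "even j") (simp_all, blast+)
      qed
      have "E i = G (2 * i)" "F i = G (2 * i + 1)" for i by (simp_all add: G_def)
      then have "A \<union> B \<subseteq> (\<Union>i. G i)" using E F by (fastforce simp: part_def)
      moreover have "G i \<subseteq> A \<union> B" for i using sub unfolding G_def by auto
      ultimately show "(\<Union>i. G i) = A \<union> B" by auto
    qed
    have "v E + v F = (\<Sum>i. ennreal \<bar>\<mu> (E i)\<bar> + ennreal \<bar>\<mu> (F i)\<bar>)"
      unfolding v_def by (rule suminf_add) auto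
    also have "\<dots> \<le> v G"
      unfolding v_def
    proof (rule suminf_le_const)
      fix n
      have "(\<Sum>i<n. ennreal \<bar>\<mu> (E i)\<bar> + ennreal \<bar>\<mu> (F i)\<bar>) = (\<Sum>i<2*n. ennreal \<bar>\<mu> (G i)\<bar>)"
        by (induction n) (auto simp: G_def add.assoc)
      also have "\<dots> \<le> (\<Sum>i. ennreal \<bar>\<mu> (G i)\<bar>)"
        by (rule sum_le_suminf) auto
      finally show "(\<Sum>i<n. ennreal \<bar>\<mu> (E i)\<bar> + ennreal \<bar>\<mu> (F i)\<bar>) \<le> (\<Sum>i. ennreal \<bar>\<mu> (G i)\<bar>)" .
    qed auto
    also have "\<dots> \<le> total_variation \<Omega> \<mu> (A \<union> B)"
      unfolding TV by (rule SUP_upper[OF Gp])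
    finally show ?thesis .
  qed
  have "v E + total_variation \<Omega> \<mu> B \<le> total_variation \<Omega> \<mu> (A \<union> B)" if "E \<in> part A" for E
    unfolding TV[of B] ennreal_SUP_add_right[OF ne[OF B]]
    by (rule SUP_least) (rule step[OF that])
  then show ?thesis
    unfolding TV[of A] ennreal_SUP_add_left[OF ne[OF A], symmetric]
    by (rule SUP_least)
qed

lemma suminf_ennreal_swap:
  fixes f :: "nat \<Rightarrow> nat \<Rightarrow> ennreal"
  shows "(\<Sum>k. \<Sum>i. f k i) = (\<Sum>i. \<Sum>k. f k i)"
proof -
  have "(\<integral>\<^sup>+k. (\<Sum>i. f k i) \<partial>count_space UNIV) = (\<Sum>i. \<integral>\<^sup>+k. f k i \<partial>count_space UNIV)"
    by (rule nn_integral_suminf) auto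
  then show ?thesis by (simp only: nn_integral_count_space_nat)
qed

text \<open>A partition \<open>E\<close> of the union is refined by the sets \<open>E k \<inter> A i\<close>; refining does not decrease the sum
  of absolute values, and the double sum of nonnegative terms may be reordered.\<close>

lemma total_variation_subadditive:
  assumes mu: "finite_signed_measure_in \<Omega> \<mu>"
    and A: "range A \<subseteq> borel_in \<Omega>" "disjoint_family A"
  shows "total_variation \<Omega> \<mu> (\<Union>i. A i) \<le> (\<Sum>i. total_variation \<Omega> \<mu> (A (i::nat)))"
  unfolding total_variation_def[of _ _ "\<Union>i. A i"]
proof (rule SUP_least, clarify)
  fix E :: "nat \<Rightarrow> _"
  assume E: "range E \<subseteq> borel_in \<Omega>" "disjoint_family E" and EA: "(\<Union>i. E i) = (\<Union>i. A i)"
  have m: "E k \<inter> A i \<in> borel_in \<Omega>" for k i using E A by blast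
  have "(\<Sum>k. ennreal \<bar>\<mu> (E k)\<bar>) \<le> (\<Sum>k. \<Sum>i. ennreal \<bar>\<mu> (E k \<inter> A i)\<bar>)"
  proof (rule suminf_le)
    fix k
    have "(\<Union>i. E k \<inter> A i) = E k" using EA by auto
    moreover have "(\<lambda>i. \<mu> (E k \<inter> A i)) sums \<mu> (\<Union>i. E k \<inter> A i)"
    proof (rule mu[unfolded finite_signed_measure_in_def, rule_format], intro conjI)
      show "disjoint_family (\<lambda>i. E k \<inter> A i)"
        using A(2) by (rule disjoint_family_on_bisimulation) auto
    qed (use m in auto)
    ultimately show "ennreal \<bar>\<mu> (E k)\<bar> \<le> (\<Sum>i. ennreal \<bar>\<mu> (E k \<inter> A i)\<bar>)"
      by (intro ennreal_abs_le_suminf) simp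
  qed auto
  also have "\<dots> = (\<Sum>i. \<Sum>k. ennreal \<bar>\<mu> (E k \<inter> A i)\<bar>)"
    by (rule suminf_ennreal_swap)
  also have "\<dots> \<le> (\<Sum>i. total_variation \<Omega> \<mu> (A i))"
  proof (rule suminf_le)
    fix i
    show "(\<Sum>k. ennreal \<bar>\<mu> (E k \<inter> A i)\<bar>) \<le> total_variation \<Omega> \<mu> (A i)"
      unfolding total_variation_def using m E EA
      by (intro SUP_upper2[where i="\<lambda>k. E k \<inter> A i"])
         (auto intro: disjoint_family_on_bisimulation[OF E(2)])
  qed auto
  finally show "(\<Sum>k. ennreal \<bar>\<mu> (E k)\<bar>) \<le> (\<Sum>i. total_variation \<Omega> \<mu> (A i))" .
qed

text \<open>The lower bound for infinite unions comes from the binary one by way of finite unions, because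
  superadditivity also gives monotonicity.\<close>

lemma countably_additive_total_variation:
  assumes mu: "finite_signed_measure_in \<Omega> \<mu>"
  shows "countably_additive (borel_in \<Omega>) (total_variation \<Omega> \<mu>)"
  unfolding countably_additive_def
proof (intro allI impI)
  fix A :: "nat \<Rightarrow> (real ^ 'a) set"
  assume A: "range A \<subseteq> borel_in \<Omega>" "disjoint_family A" and U: "(\<Union>i. A i) \<in> borel_in \<Omega>"
  have fin: "(\<Union>i<n. A i) \<in> borel_in \<Omega>" for n using A(1) by (intro sets.finite_UN) auto
  have "(\<Sum>i<n. total_variation \<Omega> \<mu> (A i)) \<le> total_variation \<Omega> \<mu> (\<Union>i<n. A i)" for n
  proof (induction n)
    case (Suc n)
    have "A i \<inter> A n = {}" if "i < n" for i
      using A(2) that by (auto simp: disjoint_family_on_def)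
    then have "(\<Union>i<n. A i) \<inter> A n = {}" by blast
    then have "total_variation \<Omega> \<mu> (\<Union>i<n. A i) + total_variation \<Omega> \<mu> (A n)
        \<le> total_variation \<Omega> \<mu> ((\<Union>i<n. A i) \<union> A n)"
      using A(1) fin by (intro total_variation_superadditive[OF mu]) auto
    also have "(\<Union>i<n. A i) \<union> A n = (\<Union>i<Suc n. A i)"
      by (auto simp: lessThan_Suc)
    finally show ?case
      unfolding sum.lessThan_Suc by (rule order_trans[OF add_right_mono[OF Suc]])
  qed simp
  moreover have "total_variation \<Omega> \<mu> (\<Union>i<n. A i) \<le> total_variation \<Omega> \<mu> (\<Union>i. A i)" for n
  proof -
    have "total_variation \<Omega> \<mu> (\<Union>i<n. A i) \<le> total_variation \<Omega> \<mu> (\<Union>i<n. A i)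
        + total_variation \<Omega> \<mu> ((\<Union>i. A i) - (\<Union>i<n. A i))" by simp
    also have "\<dots> \<le> total_variation \<Omega> \<mu> ((\<Union>i<n. A i) \<union> ((\<Union>i. A i) - (\<Union>i<n. A i)))"
      using fin U by (intro total_variation_superadditive[OF mu]) auto
    also have "(\<Union>i<n. A i) \<union> ((\<Union>i. A i) - (\<Union>i<n. A i)) = (\<Union>i. A i)" by auto
    finally show ?thesis .
  qed
  ultimately have "(\<Sum>i<n. total_variation \<Omega> \<mu> (A i)) \<le> total_variation \<Omega> \<mu> (\<Union>i. A i)" for n
    by (rule order_trans)
  then have "(\<Sum>i. total_variation \<Omega> \<mu> (A i)) \<le> total_variation \<Omega> \<mu> (\<Union>i. A i)"
    by (intro suminf_le_const summableI)
  then show "(\<Sum>i. total_variation \<Omega> \<mu> (A i)) = total_variation \<Omega> \<mu> (\<Union>i. A i)"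
    using total_variation_subadditive[OF mu A] by (rule antisym)
qed

lemma emeasure_variation_measure:
  assumes mu: "finite_signed_measure_in \<Omega> \<mu>" and A: "A \<in> borel_in \<Omega>"
  shows "emeasure (variation_measure \<Omega> \<mu>) A = total_variation \<Omega> \<mu> A"
  unfolding variation_measure_def
  by (rule emeasure_measure_of_sigma[OF sigma_algebra_borel_in _
        countably_additive_total_variation[OF mu] A])
     (simp add: positive_def total_variation_empty[OF mu])

text \<open>Both Jordan parts at once: \<open>s = 1\<close> gives the positive and \<open>s = - 1\<close> the negative one. The finite total
  variation is what turns the extended series for \<open>|\<mu>|\<close> into a real one that can be added to that of \<open>\<mu>\<close>.\<close>

lemma emeasure_Jordan_part:
  fixes \<mu> :: "(real ^ 'n) set \<Rightarrow> real"
  assumes mu: "finite_signed_measure_in \<Omega> \<mu>" and s: "s = 1 \<or> s = -1"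
    and fin: "total_variation \<Omega> \<mu> \<Omega> < \<infinity>" and A: "A \<in> borel_in \<Omega>"
  defines "f \<equiv> \<lambda>A. (enn2real (total_variation \<Omega> \<mu> A) + s * \<mu> A) / 2"
  shows "emeasure (measure_of \<Omega> (borel_in \<Omega>) (\<lambda>A. ennreal (f A))) A = ennreal (f A)"
    and "0 \<le> f A" and "ennreal (f A) \<le> total_variation \<Omega> \<mu> A"
proof -
  let ?T = "total_variation \<Omega> \<mu>"
  have le: "?T A \<le> ?T \<Omega>" if A: "A \<in> borel_in \<Omega>" for A
  proof -
    have sub: "A \<subseteq> \<Omega>" using sets.sets_into_space[OF A] by (simp add: space_restrict_space)
    have "\<Omega> \<in> borel_in \<Omega>" using sets.top[of "restrict_space borel \<Omega>"] by (simp add: space_restrict_space)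
    then have "?T A + ?T (\<Omega> - A) \<le> ?T (A \<union> (\<Omega> - A))"
      using A by (intro total_variation_superadditive[OF mu]) auto
    also have "A \<union> (\<Omega> - A) = \<Omega>" using sub by auto
    finally show ?thesis by (meson le_iff_add order_trans)
  qed
  have T: "?T A = ennreal (enn2real (?T A))" if "A \<in> borel_in \<Omega>" for A
    using le_less_trans[OF le[OF that] fin] by simp
  have abs: "\<bar>\<mu> A\<bar> \<le> enn2real (?T A)" if "A \<in> borel_in \<Omega>" for A
    using signed_measure_abs_le_total_variation[OF mu that] T[OF that]
    by (metis enn2real_nonneg ennreal_le_iff)
  have f0: "0 \<le> f A" if "A \<in> borel_in \<Omega>" for A
    using abs[OF that] s unfolding f_def by auto
  show "0 \<le> f A" by (rule f0[OF A])
  have "f A \<le> enn2real (?T A)" using abs[OF A] s unfolding f_def by auto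
  then show "ennreal (f A) \<le> ?T A" using T[OF A] by (metis ennreal_leI)
  have ca: "countably_additive (borel_in \<Omega>) (\<lambda>A. ennreal (f A))"
    unfolding countably_additive_def
  proof (intro allI impI)
    fix A :: "nat \<Rightarrow> (real ^ 'n) set"
    assume A: "range A \<subseteq> borel_in \<Omega>" "disjoint_family A" and U: "(\<Union>i. A i) \<in> borel_in \<Omega>"
    have Ai: "A i \<in> borel_in \<Omega>" for i using A by auto
    have "(\<lambda>i. ennreal (enn2real (?T (A i)))) sums ennreal (enn2real (?T (\<Union>i. A i)))"
      using countably_additive_total_variation[OF mu] A U
      unfolding T[OF Ai, symmetric] T[OF U, symmetric]
      by (simp add: countably_additive_def sums_iff)
    then have "(\<lambda>i. enn2real (?T (A i))) sums enn2real (?T (\<Union>i. A i))"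
      by (simp add: sums_ennreal)
    moreover have "(\<lambda>i. \<mu> (A i)) sums \<mu> (\<Union>i. A i)"
      using mu A unfolding finite_signed_measure_in_def by auto
    ultimately have "(\<lambda>i. f (A i)) sums f (\<Union>i. A i)"
      unfolding f_def by (intro sums_divide sums_add sums_mult)
    then have "(\<lambda>i. ennreal (f (A i))) sums ennreal (f (\<Union>i. A i))"
      using f0 Ai U by (simp add: sums_ennreal)
    then show "(\<Sum>i. ennreal (f (A i))) = ennreal (f (\<Union>i. A i))"
      by (simp add: sums_iff)
  qed
  show "emeasure (measure_of \<Omega> (borel_in \<Omega>) (\<lambda>A. ennreal (f A))) A = ennreal (f A)"
    by (rule emeasure_measure_of_sigma[OF sigma_algebra_borel_in _ ca A])
       (simp add: positive_def f_def total_variation_empty[OF mu] signed_measure_empty[OF mu])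
qed

lemma borel_in_subset_Pow: "borel_in \<Omega> \<subseteq> Pow \<Omega>"
  using sets.space_closed[of "restrict_space borel \<Omega>"] by (simp add: space_restrict_space)

lemma sigma_sets_borel_in: "sigma_sets \<Omega> (borel_in \<Omega>) = borel_in \<Omega>"
  by (simp add: sigma_algebra.sigma_sets_eq sigma_algebra_borel_in)

lemma Jordan_parts:
  fixes \<mu> :: "(real ^ 'n) set \<Rightarrow> real"
  assumes mu: "finite_signed_measure_in \<Omega> \<mu>" and fin: "total_variation \<Omega> \<mu> \<Omega> < \<infinity>"
  shows "sets (positive_part \<Omega> \<mu>) = borel_in \<Omega>" "sets (negative_part \<Omega> \<mu>) = borel_in \<Omega>"
    and "A \<in> borel_in \<Omega> \<Longrightarrow> emeasure (positive_part \<Omega> \<mu>) A \<le> total_variation \<Omega> \<mu> A"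
    and "A \<in> borel_in \<Omega> \<Longrightarrow> emeasure (negative_part \<Omega> \<mu>) A \<le> total_variation \<Omega> \<mu> A"
    and "A \<in> borel_in \<Omega> \<Longrightarrow> measure (positive_part \<Omega> \<mu>) A - measure (negative_part \<Omega> \<mu>) A = \<mu> A"
proof -
  show "sets (positive_part \<Omega> \<mu>) = borel_in \<Omega>" "sets (negative_part \<Omega> \<mu>) = borel_in \<Omega>"
    unfolding positive_part_def negative_part_def
    by (simp_all add: sets_measure_of borel_in_subset_Pow sigma_sets_borel_in)
  assume A: "A \<in> borel_in \<Omega>"
  note p = emeasure_Jordan_part[OF mu _ fin A, of 1, simplified]
  note n = emeasure_Jordan_part[OF mu _ fin A, of "-1", simplified]
  show "emeasure (positive_part \<Omega> \<mu>) A \<le> total_variation \<Omega> \<mu> A"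
    "emeasure (negative_part \<Omega> \<mu>) A \<le> total_variation \<Omega> \<mu> A"
    using p n unfolding positive_part_def negative_part_def by simp_all
  show "measure (positive_part \<Omega> \<mu>) A - measure (negative_part \<Omega> \<mu>) A = \<mu> A"
    using p n unfolding positive_part_def negative_part_def measure_def
    by (simp add: field_simps)
qed

section \<open>Densities of dominated measures\<close>

text \<open>On the set where a Radon--Nikodym density exceeds \<open>\<kappa>\<close> its integral would exceed the allowed mass, so
  the set is null. Truncating at \<open>\<kappa>\<close> then gives bounds that hold everywhere.\<close>

lemma dominated_measure_density:
  assumes fin: "finite_measure M" and sets[measurable_cong]: "sets N = sets M" and k: "0 \<le> \<kappa>"
    and le: "\<And>A. A \<in> sets M \<Longrightarrow> emeasure N A \<le> ennreal \<kappa> * emeasure M A"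
  obtains h where "h \<in> borel_measurable M" "\<And>x. 0 \<le> h x" "\<And>x. h x \<le> \<kappa>"
    "N = density M (\<lambda>x. ennreal (h x))"
proof -
  interpret finite_measure M by fact
  have "absolutely_continuous M N"
    unfolding absolutely_continuous_def
  proof
    fix A assume "A \<in> null_sets M"
    then show "A \<in> null_sets N" using le[of A] sets by (auto simp: null_sets_def)
  qed
  then obtain f where f[measurable]: "f \<in> borel_measurable M" and N: "density M f = N"
    using Radon_Nikodym sets by blast
  define B where "B = {x \<in> space M. ennreal \<kappa> < f x}"
  have B[measurable]: "B \<in> sets M" unfolding B_def by measurable
  have AE_le: "AE x in M. f x \<le> ennreal \<kappa>"
  proof (rule ccontr)
    assume not: "\<not> (AE x in M. f x \<le> ennreal \<kappa>)"
    have "(\<integral>\<^sup>+x. ennreal \<kappa> * indicator B x \<partial>M) < (\<integral>\<^sup>+x. f x * indicator B x \<partial>M)"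
    proof (rule nn_integral_less)
      show "(\<integral>\<^sup>+x. ennreal \<kappa> * indicator B x \<partial>M) \<noteq> \<infinity>"
        by (simp add: nn_integral_cmult_indicator ennreal_mult_eq_top_iff)
      show "AE x in M. ennreal \<kappa> * indicator B x \<le> f x * indicator B x"
        by (auto simp: B_def indicator_def)
      show "\<not> (AE x in M. f x * indicator B x \<le> ennreal \<kappa> * indicator B x)"
      proof
        assume "AE x in M. f x * indicator B x \<le> ennreal \<kappa> * indicator B x"
        then have "AE x in M. f x \<le> ennreal \<kappa>"
          using AE_space
          by eventually_elim (force simp: B_def indicator_def not_less[symmetric])
        with not show False by simp
      qed
    qed measurable
    moreover have "(\<integral>\<^sup>+x. f x * indicator B x \<partial>M) = emeasure N B"
      unfolding N[symmetric] by (simp add: emeasure_density)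
    moreover have "emeasure N B \<le> (\<integral>\<^sup>+x. ennreal \<kappa> * indicator B x \<partial>M)"
      using le[OF B] by (simp add: nn_integral_cmult_indicator)
    ultimately show False by simp
  qed
  define h where "h x = min \<kappa> (enn2real (f x))" for x
  show ?thesis
  proof
    show h[measurable]: "h \<in> borel_measurable M" unfolding h_def by measurable
    show "0 \<le> h x" "h x \<le> \<kappa>" for x using k by (simp_all add: h_def)
    have "AE x in M. f x = ennreal (h x)"
      using AE_le
    proof eventually_elim
      case (elim x)
      then have "enn2real (f x) \<le> \<kappa>" using k by (metis enn2real_ennreal enn2real_mono ennreal_less_top)
      moreover have "f x < top" using elim le_less_trans ennreal_less_top by blast
      ultimately show ?case by (simp add: h_def min_def)
    qed
    then show "N = density M (\<lambda>x. ennreal (h x))"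
      unfolding N[symmetric] by (intro density_cong) auto
  qed
qed

lemma finite_measure_pushforward:
  fixes v :: "'a \<Rightarrow> real"
  assumes X[measurable]: "X \<in> measurable Q M" and v: "integrable Q v" and v0: "\<And>q. 0 \<le> v q"
  shows "finite_measure (distr (density Q v) M X)"
proof (rule finite_measureI)
  have [measurable]: "v \<in> borel_measurable Q" using v by auto
  have "emeasure (density Q v) (space Q) = (\<integral>\<^sup>+q. v q \<partial>Q)"
    by (auto simp: emeasure_density indicator_def intro!: nn_integral_cong)
  also have "\<dots> = ennreal (LINT q|Q. v q)" by (rule nn_integral_eq_integral[OF v]) (simp add: v0)
  finally have "emeasure (density Q v) (space Q) < \<infinity>" by simp
  moreover have "X -` space M \<inter> space Q = space Q" using measurable_space[OF X] by auto
  ultimately show "emeasure (distr (density Q v) M X) (space (distr (density Q v) M X)) \<noteq> \<infinity>"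
    by (simp add: emeasure_distr)
qed

text \<open>The image under \<open>X\<close> of the weight \<open>g\<close> is dominated by \<open>\<kappa>\<close> times that of \<open>v\<close>, hence has a bounded
  density with respect to it. Probabilistically, \<open>h\<close> is the conditional expectation of \<open>g / v\<close> given \<open>X\<close>.\<close>

lemma pushforward_nonneg_multiplier:
  fixes v g :: "'a \<Rightarrow> real" and X :: "'a \<Rightarrow> 'b::topological_space"
  assumes X[measurable]: "X \<in> measurable Q borel" and v: "integrable Q v" and v0: "\<And>q. 0 \<le> v q"
    and g[measurable]: "g \<in> borel_measurable Q" and g0: "\<And>q. 0 \<le> g q"
    and gv: "\<And>q. q \<in> space Q \<Longrightarrow> g q \<le> \<kappa> * v q" and k: "0 \<le> \<kappa>"
  obtains h where "h \<in> borel_measurable borel" "\<And>x. 0 \<le> h x" "\<And>x. h x \<le> \<kappa>"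
    "\<And>f :: 'b \<Rightarrow> real. f \<in> borel_measurable borel \<Longrightarrow>
      (LINT q|Q. f (X q) * g q) = (LINT x|distr (density Q v) borel X. f x * h x)"
proof -
  have [measurable]: "v \<in> borel_measurable Q" using v by auto
  define M where "M = distr (density Q v) borel X"
  define N where "N = distr (density Q g) borel X"
  have sM[measurable_cong]: "sets M = sets borel" "sets N = sets M" by (simp_all add: M_def N_def)
  have fin: "finite_measure M"
    unfolding M_def by (rule finite_measure_pushforward[OF X v v0])
  have le: "emeasure N A \<le> ennreal \<kappa> * emeasure M A" if A[measurable]: "A \<in> sets M" for A
  proof -
    have [measurable]: "A \<in> sets borel" using A by (simp add: sM)
    have "emeasure N A = (\<integral>\<^sup>+q. ennreal (g q) * indicator (X -` A \<inter> space Q) q \<partial>Q)"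
      by (simp add: N_def emeasure_distr emeasure_density)
    also have "\<dots> \<le> (\<integral>\<^sup>+q. ennreal \<kappa> * (ennreal (v q) * indicator (X -` A \<inter> space Q) q) \<partial>Q)"
      using gv k by (intro nn_integral_mono) (auto simp: indicator_def ennreal_mult'[symmetric] intro!: ennreal_leI)
    also have "\<dots> = ennreal \<kappa> * emeasure M A"
      by (simp add: M_def emeasure_distr emeasure_density nn_integral_cmult)
    finally show ?thesis .
  qed
  obtain h where h: "h \<in> borel_measurable M" "\<And>x. 0 \<le> h x" "\<And>x. h x \<le> \<kappa>"
    and N: "N = density M (\<lambda>x. ennreal (h x))"
    using dominated_measure_density[OF fin sM(2) k le] by blast
  have hb[measurable]: "h \<in> borel_measurable borel" using h(1) by (simp add: M_def)
  have "(LINT q|Q. f (X q) * g q) = (LINT x|M. f x * h x)" if f[measurable]: "f \<in> borel_measurable borel"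
    for f :: "'b \<Rightarrow> real"
  proof -
    have "(LINT q|Q. f (X q) * g q) = (LINT q|density Q g. f (X q))"
      using g0 by (subst integral_density) (auto simp: mult.commute)
    also have "\<dots> = (LINT x|N. f x)" unfolding N_def by (rule integral_distr[symmetric]) measurable
    also have "\<dots> = (LINT x|M. f x * h x)"
      unfolding N using h(2) by (subst integral_density) (auto simp: mult.commute M_def)
    finally show ?thesis .
  qed
  then show ?thesis using that[of h] hb h(2,3) unfolding M_def by blast
qed

text \<open>The positive and negative parts of \<open>g\<close> have multipliers in \<open>[0, \<kappa>]\<close>, so the difference of these
  lies in \<open>[- \<kappa>, \<kappa>]\<close>.\<close>

lemma pushforward_multiplier:
  fixes v g :: "'a \<Rightarrow> real" and X :: "'a \<Rightarrow> 'b::topological_space"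
  assumes X[measurable]: "X \<in> measurable Q borel" and v: "integrable Q v" and v0: "\<And>q. 0 \<le> v q"
    and g[measurable]: "g \<in> borel_measurable Q"
    and gv: "\<And>q. q \<in> space Q \<Longrightarrow> \<bar>g q\<bar> \<le> \<kappa> * v q" and k: "0 \<le> \<kappa>"
  obtains h where "h \<in> borel_measurable borel" "\<And>x. \<bar>h x\<bar> \<le> \<kappa>"
    "\<And>(f :: 'b \<Rightarrow> real) B. f \<in> borel_measurable borel \<Longrightarrow> (\<And>x. \<bar>f x\<bar> \<le> B) \<Longrightarrow>
      (LINT q|Q. f (X q) * g q) = (LINT x|distr (density Q v) borel X. f x * h x)"
proof -
  have [measurable]: "v \<in> borel_measurable Q" using v by auto
  let ?M = "distr (density Q v) borel X"
  have fin: "finite_measure ?M" by (rule finite_measure_pushforward[OF X v v0])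
  have le: "max 0 (g q) \<le> \<kappa> * v q" "max 0 (- g q) \<le> \<kappa> * v q" if "q \<in> space Q" for q
    using gv[OF that] k v0 by (auto simp: abs_le_iff)
  obtain h1 where h1[measurable]: "h1 \<in> borel_measurable borel" and b1: "\<And>x. 0 \<le> h1 x" "\<And>x. h1 x \<le> \<kappa>"
    and i1: "\<And>f :: 'b \<Rightarrow> real. f \<in> borel_measurable borel \<Longrightarrow>
      (LINT q|Q. f (X q) * max 0 (g q)) = (LINT x|?M. f x * h1 x)"
    by (rule pushforward_nonneg_multiplier[of X Q v "\<lambda>q. max 0 (g q)", OF X v v0 _ _ le(1) k]) auto
  obtain h2 where h2[measurable]: "h2 \<in> borel_measurable borel" and b2: "\<And>x. 0 \<le> h2 x" "\<And>x. h2 x \<le> \<kappa>"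
    and i2: "\<And>f :: 'b \<Rightarrow> real. f \<in> borel_measurable borel \<Longrightarrow>
      (LINT q|Q. f (X q) * max 0 (- g q)) = (LINT x|?M. f x * h2 x)"
    by (rule pushforward_nonneg_multiplier[of X Q v "\<lambda>q. max 0 (- g q)", OF X v v0 _ _ le(2) k]) auto
  show ?thesis
  proof
    show "(\<lambda>x. h1 x - h2 x) \<in> borel_measurable borel" by measurable
    show "\<bar>h1 x - h2 x\<bar> \<le> \<kappa>" for x using b1[of x] b2[of x] by linarith
    fix f :: "'b \<Rightarrow> real" and B assume f[measurable]: "f \<in> borel_measurable borel" and B: "\<And>x. \<bar>f x\<bar> \<le> B"
    have B0: "0 \<le> B" using B[of undefined] by linarith
    have intQ: "integrable Q (\<lambda>q. f (X q) * g' q)"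
      if [measurable]: "g' \<in> borel_measurable Q" and g': "\<And>q. q \<in> space Q \<Longrightarrow> \<bar>g' q\<bar> \<le> \<kappa> * v q" for g'
    proof (rule Bochner_Integration.integrable_bound)
      show "integrable Q (\<lambda>q. B * (\<kappa> * v q))" using v by auto
      show "AE q in Q. norm (f (X q) * g' q) \<le> norm (B * (\<kappa> * v q))"
      proof (rule AE_I2)
        fix q assume "q \<in> space Q"
        then have "\<bar>f (X q)\<bar> * \<bar>g' q\<bar> \<le> B * (\<kappa> * v q)"
          using B0 B g' by (intro mult_mono) auto
        then show "norm (f (X q) * g' q) \<le> norm (B * (\<kappa> * v q))"
          using B0 k v0 by (simp add: abs_mult)
      qed
    qed measurable
    have intM: "integrable ?M (\<lambda>x. f x * h x)"
      if [measurable]: "h \<in> borel_measurable borel" and h: "\<And>x. \<bar>h x\<bar> \<le> \<kappa>" for h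
    proof -
      interpret finite_measure ?M by (rule fin)
      have "\<bar>f x * h x\<bar> \<le> B * \<kappa>" for x
        unfolding abs_mult using B0 B h by (intro mult_mono) auto
      then show ?thesis by (intro integrable_const_bound[of _ "B * \<kappa>"]) auto
    qed
    have "(LINT q|Q. f (X q) * g q) = (LINT q|Q. f (X q) * max 0 (g q) - f (X q) * max 0 (- g q))"
      by (intro Bochner_Integration.integral_cong) (auto simp: max_def algebra_simps)
    also have "\<dots> = (LINT q|Q. f (X q) * max 0 (g q)) - (LINT q|Q. f (X q) * max 0 (- g q))"
      using le by (intro Bochner_Integration.integral_diff intQ) auto
    also have "\<dots> = (LINT x|?M. f x * h1 x) - (LINT x|?M. f x * h2 x)"
      by (simp only: i1[OF f] i2[OF f])
    also have "\<dots> = (LINT x|?M. f x * h1 x - f x * h2 x)"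
      using b1 b2 by (intro Bochner_Integration.integral_diff[symmetric] intM) auto
    also have "\<dots> = (LINT x|?M. f x * (h1 x - h2 x))"
      by (simp add: right_diff_distrib)
    finally show "(LINT q|Q. f (X q) * g q) = (LINT x|?M. f x * (h1 x - h2 x))" .
  qed
qed

text \<open>Each Jordan part is bounded by \<open>|\<mu>|\<close> and so has a density in \<open>[0, \<kappa>]\<close>; the density of \<open>\<mu>\<close> is the
  difference. From here on the signed measure enters only through \<open>h\<close>.\<close>

lemma signed_measure_density:
  fixes \<mu> :: "(real ^ 'n) set \<Rightarrow> real"
  assumes sM: "sets M = borel_in \<Omega>" and fM: "finite_measure M"
    and mu: "finite_signed_measure_in \<Omega> \<mu>" and k: "0 \<le> \<kappa>"
    and le: "\<And>A. A \<in> borel_in \<Omega> \<Longrightarrow> emeasure (variation_measure \<Omega> \<mu>) A \<le> ennreal \<kappa> * emeasure M A"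
  obtains h where "h \<in> borel_measurable M" "\<And>x. \<bar>h x\<bar> \<le> \<kappa>"
    "\<And>f B. f \<in> borel_measurable M \<Longrightarrow> (\<And>x. x \<in> \<Omega> \<Longrightarrow> \<bar>f x\<bar> \<le> B) \<Longrightarrow>
      signed_integral \<Omega> \<mu> f = (LINT x|M. f x * h x)"
    "\<mu> \<Omega> = (LINT x|M. h x)"
proof -
  interpret M: finite_measure M by fact
  have spM: "space M = \<Omega>" using sets_eq_imp_space_eq[OF sM] by (simp add: space_restrict_space)
  have top: "\<Omega> \<in> borel_in \<Omega>" using sets.top[of M] by (simp add: spM sM)
  note TV = emeasure_variation_measure[OF mu]
  have "ennreal \<kappa> * emeasure M \<Omega> < \<infinity>"
    using M.emeasure_finite[of \<Omega>] by (auto simp: less_top[symmetric] ennreal_mult_eq_top_iff)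
  then have fin: "total_variation \<Omega> \<mu> \<Omega> < \<infinity>"
    using le[OF top] TV[OF top] by (metis le_less_trans)
  note J = Jordan_parts[OF mu fin]
  have le': "emeasure (positive_part \<Omega> \<mu>) A \<le> ennreal \<kappa> * emeasure M A"
    "emeasure (negative_part \<Omega> \<mu>) A \<le> ennreal \<kappa> * emeasure M A" if "A \<in> sets M" for A
    using J(3,4)[of A] le[of A] TV[of A] that unfolding sM by (metis order_trans)+
  obtain p where p[measurable]: "p \<in> borel_measurable M" and pb: "\<And>x. 0 \<le> p x" "\<And>x. p x \<le> \<kappa>"
    and P: "positive_part \<Omega> \<mu> = density M (\<lambda>x. ennreal (p x))"
    using dominated_measure_density[OF fM _ k le'(1)] J(1) sM by metis
  obtain n where n[measurable]: "n \<in> borel_measurable M" and nb: "\<And>x. 0 \<le> n x" "\<And>x. n x \<le> \<kappa>"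
    and N: "negative_part \<Omega> \<mu> = density M (\<lambda>x. ennreal (n x))"
    using dominated_measure_density[OF fM _ k le'(2)] J(2) sM by metis
  have int: "integrable M (\<lambda>x. f x * g x)" if [measurable]: "f \<in> borel_measurable M" "g \<in> borel_measurable M"
    and f: "\<And>x. x \<in> \<Omega> \<Longrightarrow> \<bar>f x\<bar> \<le> B" and g: "\<And>x. 0 \<le> g x" "\<And>x. g x \<le> \<kappa>" for f g B
  proof (rule M.integrable_const_bound)
    show "AE x in M. norm (f x * g x) \<le> B * \<kappa>"
    proof (rule AE_I2)
      fix x assume "x \<in> space M"
      then have "\<bar>f x\<bar> * \<bar>g x\<bar> \<le> B * \<kappa>"
        using f[of x] g[of x] by (intro mult_mono) (auto simp: spM)
      then show "norm (f x * g x) \<le> B * \<kappa>" by (simp add: abs_mult)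
    qed
  qed measurable
  have rep: "signed_integral \<Omega> \<mu> f = (LINT x|M. f x * (p x - n x))"
    if f[measurable]: "f \<in> borel_measurable M" and B: "\<And>x. x \<in> \<Omega> \<Longrightarrow> \<bar>f x\<bar> \<le> B" for f B
  proof -
    have "signed_integral \<Omega> \<mu> f = (LINT x|M. f x * p x) - (LINT x|M. f x * n x)"
      unfolding signed_integral_def P N using pb nb
      by (subst (1 2) integral_density) (auto simp: mult.commute)
    also have "\<dots> = (LINT x|M. f x * p x - f x * n x)"
      by (intro Bochner_Integration.integral_diff[symmetric] int[OF f _ B]) (use pb nb in auto)
    also have "\<dots> = (LINT x|M. f x * (p x - n x))" by (simp add: right_diff_distrib)
    finally show ?thesis .
  qed
  show ?thesis
  proof
    show "(\<lambda>x. p x - n x) \<in> borel_measurable M" by measurable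
    show "\<bar>p x - n x\<bar> \<le> \<kappa>" for x using pb[of x] nb[of x] by linarith
    show "signed_integral \<Omega> \<mu> f = (LINT x|M. f x * (p x - n x))"
      if "f \<in> borel_measurable M" "\<And>x. x \<in> \<Omega> \<Longrightarrow> \<bar>f x\<bar> \<le> B" for f B by (rule rep[OF that])
    have "space (positive_part \<Omega> \<mu>) = \<Omega>" "space (negative_part \<Omega> \<mu>) = \<Omega>"
      by (simp_all add: P N spM)
    then have "signed_integral \<Omega> \<mu> (\<lambda>_. 1) = \<mu> \<Omega>"
      using J(5)[OF top] by (simp add: signed_integral_def)
    then show "\<mu> \<Omega> = (LINT x|M. p x - n x)"
      using rep[of "\<lambda>_. 1" 1] by simp
  qed
qed

section \<open>Inscribed polygons\<close>

text \<open>The condition on \<open>v 0\<close> matters for \<open>n = 0\<close>, where there is no segment.\<close>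

definition polygon_in :: "'a::real_normed_vector set \<Rightarrow> nat \<Rightarrow> (nat \<Rightarrow> 'a) \<Rightarrow> bool" where
  "polygon_in S n v \<longleftrightarrow> v 0 \<in> S \<and> (\<forall>i<n. closed_segment (v i) (v (Suc i)) \<subseteq> S)"

definition polygon_length :: "nat \<Rightarrow> (nat \<Rightarrow> 'a::metric_space) \<Rightarrow> real" where
  "polygon_length n v = (\<Sum>i<n. dist (v i) (v (Suc i)))"

lemma polygon_length_nonneg: "0 \<le> polygon_length n v"
  unfolding polygon_length_def by (intro sum_nonneg) auto

text \<open>A polygon inscribed in a path stays in the open set once its mesh is below the distance from the
  path to the complement, and it is never longer than the path.\<close>

lemma inscribed_polygon:
  fixes g :: "real \<Rightarrow> real ^ 'n"
  assumes S: "open S" and g: "rectifiable_path g" and gS: "path_image g \<subseteq> S"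
  obtains n v where "polygon_in S n v" "v 0 = pathstart g" "v n = pathfinish g"
    "polygon_length n v \<le> enn2real (path_length g)"
proof -
  have cont: "continuous_on {0..1} g" and fin: "path_length g < \<infinity>"
    using g by (auto simp: rectifiable_path_def path_def)
  obtain \<delta> where \<delta>: "\<delta> > 0" "(\<Union>x\<in>path_image g. ball x \<delta>) \<subseteq> S"
    using compact_subset_open_imp_ball_epsilon_subset[of "path_image g" S] compact_path_image S gS g
    unfolding rectifiable_path_def by metis
  have "uniformly_continuous_on {0..1} g"
    using cont by (simp add: compact_uniformly_continuous)
  then obtain e where e: "e > 0" "\<And>s t. s \<in> {0..1} \<Longrightarrow> t \<in> {0..1} \<Longrightarrow> dist t s < e \<Longrightarrow> dist (g t) (g s) < \<delta>"
    unfolding uniformly_continuous_on_def using \<delta>(1) by metis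
  obtain N :: nat where N: "N > 0" "1 / N < e"
    using e(1) by (metis nat_approx_posE of_nat_0_less_iff zero_less_Suc)
  define v where "v i = g (real i / real N)" for i
  have *: "closed_segment (v i) (v (Suc i)) \<subseteq> S" if "i < N" for i
  proof -
    have t: "real i / N \<in> {0..1}" "real (Suc i) / N \<in> {0..1}"
      using that N by (auto simp: field_simps)
    have "dist (real (Suc i) / N) (real i / N) = 1 / N"
      using N by (simp add: dist_real_def field_simps)
    then have "dist (v (Suc i)) (v i) < \<delta>" unfolding v_def using e(2)[OF t] N by simp
    then have "closed_segment (v i) (v (Suc i)) \<subseteq> ball (v i) \<delta>"
      using \<delta>(1) by (intro closed_segment_subset) (auto simp: dist_commute)
    moreover have "v i \<in> path_image g" using t by (auto simp: v_def path_image_def)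
    ultimately show ?thesis using \<delta>(2) by blast
  qed
  have v0: "v 0 = pathstart g" and vN: "v N = pathfinish g"
    using N by (auto simp: v_def pathstart_def pathfinish_def)
  have "v 0 \<in> S" using gS by (auto simp: v0)
  with * have poly: "polygon_in S N v" by (simp add: polygon_in_def)
  have "ennreal (polygon_length N v) \<le> path_length g"
    unfolding path_length_def polygon_length_def v_def
    by (rule SUP_upper2[where i="(N, \<lambda>i. real i / real N)"]) (use N in \<open>auto simp: field_simps\<close>)
  then have "polygon_length N v \<le> enn2real (path_length g)"
    using fin polygon_length_nonneg by (metis enn2real_ennreal enn2real_mono infinity_ennreal_def)
  with poly v0 vN that show ?thesis by blast
qed

lemma path_length_Lipschitz:
  fixes g :: "real \<Rightarrow> real ^ 'n"
  assumes g: "L-lipschitz_on {0..1} g"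
  shows "path_length g \<le> ennreal L"
  unfolding path_length_def
proof (rule SUP_least, clarify)
  fix k and t :: "nat \<Rightarrow> real"
  assume t: "t 0 = 0" "t k = 1" "\<forall>i<k. t i \<le> t (Suc i)"
  have mono: "t i \<le> t j" if "i \<le> j" "j \<le> k" for i j
    using that by (induction j rule: dec_induct) (use t in \<open>auto intro: order_trans\<close>)
  have t01: "t i \<in> {0..1}" if "i \<le> k" for i using mono[of 0 i] mono[of i k] t that by auto
  have "(\<Sum>i<k. dist (g (t i)) (g (t (Suc i)))) \<le> (\<Sum>i<k. L * (t (Suc i) - t i))"
  proof (rule sum_mono)
    fix i assume "i \<in> {..<k}"
    then have "dist (g (t i)) (g (t (Suc i))) \<le> L * dist (t i) (t (Suc i))"
      using lipschitz_onD[OF g t01 t01] by auto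
    also have "dist (t i) (t (Suc i)) = t (Suc i) - t i"
      using t \<open>i \<in> _\<close> by (auto simp: dist_real_def)
    finally show "dist (g (t i)) (g (t (Suc i))) \<le> L * (t (Suc i) - t i)" .
  qed
  also have "\<dots> = L * (t k - t 0)"
    by (simp add: sum_distrib_left[symmetric] sum_lessThan_telescope)
  finally show "ennreal (\<Sum>i<k. dist (g (t i)) (g (t (Suc i)))) \<le> ennreal L"
    using t by (intro ennreal_leI) simp
qed

text \<open>A polynomial path in the open set is Lipschitz on the unit interval. Without a rectifiable curve
  the infimum in \<open>inner_dist\<close> would be that of the empty set and would bound nothing.\<close>

lemma rectifiable_path_exists:
  fixes x y :: "real ^ 'n"
  assumes "open U" "connected U" "x \<in> U" "y \<in> U"
  obtains g where "rectifiable_path g" "path_image g \<subseteq> U" "pathstart g = x" "pathfinish g = y"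
proof -
  obtain g where g: "polynomial_function g" "path_image g \<subseteq> U" "pathstart g = x" "pathfinish g = y"
    using connected_open_polynomial_connected[OF assms] by blast
  obtain g' where g': "polynomial_function g'" "\<And>t. (g has_vector_derivative g' t) (at t)"
    using has_vector_derivative_polynomial_function[OF g(1)] by blast
  have "compact (g' ` {0..1})"
    by (intro compact_continuous_image continuous_on_polymonial_function g') auto
  then obtain B where B: "\<And>t. t \<in> {0..1} \<Longrightarrow> norm (g' t) \<le> B"
    using compact_imp_bounded bounded_iff by (metis imageI)
  have "B-lipschitz_on {0..1} g"
  proof (rule lipschitz_onI)
    show "0 \<le> B" using order_trans[OF norm_ge_zero B[of 0]] by simp
    fix s t :: real assume st: "s \<in> {0..1}" "t \<in> {0..1}"
    have "norm (g s - g t) \<le> B * norm (s - t)"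
    proof (rule differentiable_bound[where S="{0..1}" and f'="\<lambda>t h. h *\<^sub>R g' t"])
      show "(g has_derivative (\<lambda>h. h *\<^sub>R g' t)) (at t within {0..1})" for t
        using g'(2)[of t] unfolding has_vector_derivative_def by (rule has_derivative_at_withinI)
      show "onorm (\<lambda>h. h *\<^sub>R g' t) \<le> B" if "t \<in> {0..1}" for t
        using B[OF that] by (intro onorm_le) (simp add: mult.commute[of "\<bar>_\<bar>"] mult_right_mono)
    qed (use st in auto)
    then show "dist (g s) (g t) \<le> B * dist s t" by (simp add: dist_norm)
  qed
  then have "path_length g < \<infinity>" using path_length_Lipschitz by (metis ennreal_less_top infinity_ennreal_def le_less_trans)
  moreover have "path g"
    unfolding path_def by (intro continuous_on_polymonial_function g)
  ultimately show ?thesis using g that by (auto simp: rectifiable_path_def)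
qed

section \<open>A measurable choice of polygons\<close>

definition polygon_lengths :: "'a::real_normed_vector set \<Rightarrow> 'a \<Rightarrow> 'a \<Rightarrow> real set" where
  "polygon_lengths S x y = {polygon_length n v |n v. polygon_in S n v \<and> v 0 = x \<and> v n = y}"

lemma bdd_below_polygon_lengths: "bdd_below (polygon_lengths S x y)"
  unfolding polygon_lengths_def by (rule bdd_belowI[of _ 0]) (auto simp: polygon_length_nonneg)

lemma polygon_lengths_prefix:
  assumes "L \<in> polygon_lengths S y z" "closed_segment x y \<subseteq> S"
  shows "dist x y + L \<in> polygon_lengths S x z"
proof -
  obtain n v where v: "polygon_in S n v" "v 0 = y" "v n = z" "L = polygon_length n v"
    using assms(1) by (auto simp: polygon_lengths_def)
  have "closed_segment (case_nat x v i) (case_nat x v (Suc i)) \<subseteq> S" if "i < Suc n" for i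
    using v assms(2) that by (cases i) (simp_all add: polygon_in_def)
  moreover have "x \<in> S" using assms(2) by auto
  ultimately have "polygon_in S (Suc n) (case_nat x v)" by (simp add: polygon_in_def)
  moreover have "dist x y + L = polygon_length (Suc n) (case_nat x v)"
    unfolding polygon_length_def v(4) sum.lessThan_Suc_shift by (simp add: v(2))
  moreover have "case_nat x v (Suc n) = z" using v(3) by simp
  ultimately show ?thesis
    unfolding polygon_lengths_def by (intro CollectI exI[of _ "Suc n"] exI[of _ "case_nat x v"]) simp
qed

text \<open>The infimum of polygon lengths replaces \<open>inner_dist\<close> in comparisons of nearby points, since a
  segment is easily put in front of a polygon.\<close>

lemma Inf_polygon_lengths_le:
  assumes ne: "polygon_lengths S y z \<noteq> {}" and seg: "closed_segment x y \<subseteq> S"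
  shows "Inf (polygon_lengths S x z) \<le> dist x y + Inf (polygon_lengths S y z)"
proof -
  have "Inf (polygon_lengths S x z) - dist x y \<le> Inf (polygon_lengths S y z)"
  proof (rule cInf_greatest[OF ne])
    fix L assume "L \<in> polygon_lengths S y z"
    then have "Inf (polygon_lengths S x z) \<le> dist x y + L"
      by (intro cInf_lower polygon_lengths_prefix bdd_below_polygon_lengths seg)
    then show "Inf (polygon_lengths S x z) - dist x y \<le> L" by simp
  qed
  then show ?thesis by simp
qed

lemma polygon_lengths_connected:
  fixes x y :: "real ^ 'n"
  assumes S: "open S" and U: "open U" "connected U" "U \<subseteq> S" and xy: "x \<in> U" "y \<in> U"
  shows "polygon_lengths S x y \<noteq> {}" and "Inf (polygon_lengths S x y) \<le> inner_dist S y x"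
proof -
  obtain g where g: "rectifiable_path g" "path_image g \<subseteq> S" "pathstart g = x" "pathfinish g = y"
    using rectifiable_path_exists[OF U(1,2) xy] U(3) by (metis subset_trans)
  obtain n v where "polygon_in S n v" "v 0 = x" "v n = y"
    using inscribed_polygon[OF S g(1,2)] unfolding g(3,4) by blast
  then show "polygon_lengths S x y \<noteq> {}" unfolding polygon_lengths_def by blast
  show "Inf (polygon_lengths S x y) \<le> inner_dist S y x"
    unfolding inner_dist_def
  proof (rule cInf_greatest)
    show "{enn2real (path_length g) |g. rectifiable_path g \<and> path_image g \<subseteq> S \<and>
        pathstart g = x \<and> pathfinish g = y} \<noteq> {}" using g by auto
    fix L assume "L \<in> {enn2real (path_length g) |g. rectifiable_path g \<and> path_image g \<subseteq> S \<and>
        pathstart g = x \<and> pathfinish g = y}"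
    then obtain g where g: "rectifiable_path g" "path_image g \<subseteq> S" "pathstart g = x" "pathfinish g = y"
      and L: "L = enn2real (path_length g)" by auto
    obtain n v where v: "polygon_in S n v" "v 0 = x" "v n = y" "polygon_length n v \<le> L"
      using inscribed_polygon[OF S g(1,2)] unfolding L g(3,4) by blast
    then have "Inf (polygon_lengths S x y) \<le> polygon_length n v"
      by (intro cInf_lower bdd_below_polygon_lengths) (auto simp: polygon_lengths_def)
    with v(4) show "Inf (polygon_lengths S x y) \<le> L" by simp
  qed
qed

lemma polygon_in_vertex:
  assumes "polygon_in S n v" "i \<le> n"
  shows "v i \<in> S"
proof (cases i)
  case (Suc m)
  then have "closed_segment (v m) (v i) \<subseteq> S" using assms by (simp add: polygon_in_def)
  then show ?thesis using ends_in_segment by blast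
qed (use assms in \<open>simp add: polygon_in_def\<close>)

lemma polygon_thickness:
  fixes v :: "nat \<Rightarrow> 'a::euclidean_space"
  assumes S: "open S" and v: "polygon_in S n v"
  obtains e where "0 < e" "e \<le> 1" "\<And>i. i \<le> n \<Longrightarrow> ball (v i) e \<subseteq> S"
    "\<And>i x. i < n \<Longrightarrow> x \<in> closed_segment (v i) (v (Suc i)) \<Longrightarrow> ball x e \<subseteq> S"
proof -
  define K where "K = v ` {..n} \<union> (\<Union>i<n. closed_segment (v i) (v (Suc i)))"
  have "compact K" unfolding K_def by (intro compact_Un compact_UN finite_imp_compact ballI compact_segment) simp_all
  moreover have "K \<subseteq> S" using v polygon_in_vertex[OF v] by (auto simp: K_def polygon_in_def)
  ultimately obtain d where d: "d > 0" "(\<Union>x\<in>K. ball x d) \<subseteq> S"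
    by (elim compact_subset_open_imp_ball_epsilon_subset[OF _ S])
  have "ball x (min d 1) \<subseteq> S" if "x \<in> K" for x
    using d(2) that subset_ball[of "min d 1" d x] by auto
  then show ?thesis using d(1) that[of "min d 1"] by (auto simp: K_def)
qed

lemma closed_segment_translate_ball:
  fixes a b z :: "'a::real_normed_vector"
  assumes "\<And>x. x \<in> closed_segment a b \<Longrightarrow> ball x e \<subseteq> S" and "norm z < e"
  shows "closed_segment (a + z) (b + z) \<subseteq> S"
proof
  fix w assume "w \<in> closed_segment (a + z) (b + z)"
  then obtain u where u: "0 \<le> u" "u \<le> 1" "w = (1 - u) *\<^sub>R (a + z) + u *\<^sub>R (b + z)"
    by (auto simp: in_segment)
  have "w = ((1 - u) *\<^sub>R a + u *\<^sub>R b) + z" unfolding u(3) by (simp add: algebra_simps)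
  moreover have "(1 - u) *\<^sub>R a + u *\<^sub>R b \<in> closed_segment a b" using u by (auto simp: in_segment)
  moreover have "c + z \<in> ball c e" for c using assms(2) by (simp add: dist_norm)
  ultimately show "w \<in> S" using assms(1) by blast
qed

lemma countable_ball_cover:
  fixes U :: "'a::euclidean_space set"
  assumes ne: "U \<noteq> {}" and e: "\<And>y. y \<in> U \<Longrightarrow> 0 < e y"
  obtains q :: "nat \<Rightarrow> 'a" where "\<And>j. q j \<in> U" "\<And>y. y \<in> U \<Longrightarrow> \<exists>j. y \<in> ball (q j) (e (q j))"
proof -
  obtain F where F: "F \<subseteq> (\<lambda>y. ball y (e y)) ` U" "countable F" "\<Union>F = (\<Union>y\<in>U. ball y (e y))"
    by (rule Lindelof[of "(\<lambda>y. ball y (e y)) ` U"]) auto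
  obtain Y where Y: "countable Y" "Y \<subseteq> U" "F = (\<lambda>y. ball y (e y)) ` Y"
    using F(1,2) countable_subset_image[THEN iffD1, OF conjI, of F "\<lambda>y. ball y (e y)" U] by blast
  have UY: "U \<subseteq> (\<Union>y\<in>Y. ball y (e y))"
    using F(3) e unfolding Y(3) by auto
  then have Yne: "Y \<noteq> {}" using ne by auto
  show ?thesis
  proof
    show "from_nat_into Y j \<in> U" for j using from_nat_into[OF Yne] Y(2) by auto
    show "\<exists>j. y \<in> ball (from_nat_into Y j) (e (from_nat_into Y j))" if y: "y \<in> U" for y
    proof -
      obtain c where "c \<in> Y" "y \<in> ball c (e c)" using UY y by blast
      moreover obtain j where "from_nat_into Y j = c"
        using from_nat_into_surj[OF Y(1) \<open>c \<in> Y\<close>] by blast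
      ultimately show ?thesis by blast
    qed
  qed
qed

text \<open>The point \<open>y\<close> is assigned to the first ball of a countable cover that contains it. Its chain runs from
  \<open>y\<close> to the centre \<open>q\<close> of this ball, along a nearly shortest polygon from \<open>q\<close> to \<open>x0\<close>, and then stays at
  \<open>x0\<close>. The radius \<open>R\<close> is \<open>0\<close> at \<open>y\<close>, then the thickness of the polygon, and at the end the common value
  \<open>\<epsilon>\<close>. The constant \<open>5\<close> collects the detour to \<open>q\<close>, counted once for the step itself and once for the
  change in distance, the two changes of radius, and the excess of the polygon over the infimum; each is at most \<open>1\<close>.\<close>

lemma fattened_polygons:
  fixes S U :: "(real ^ 'n) set"
  assumes S: "open S" and U: "open U" "connected U" "U \<subseteq> S" and x0: "x0 \<in> U"
  obtains P :: "real ^ 'n \<Rightarrow> nat \<Rightarrow> real ^ 'n" and R :: "real ^ 'n \<Rightarrow> nat \<Rightarrow> real" and \<epsilon> :: real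
  where "\<And>i. (\<lambda>y. P y i) \<in> borel_measurable borel" "\<And>i. (\<lambda>y. R y i) \<in> borel_measurable borel"
    "\<And>y. P y 0 = y" "\<And>y. R y 0 = 0" "\<And>y i. 0 < R y (Suc i)"
    "\<And>y i z. y \<in> U \<Longrightarrow> norm z < 1 \<Longrightarrow>
       closed_segment (P y i + R y i *\<^sub>R z) (P y (Suc i) + R y (Suc i) *\<^sub>R z) \<subseteq> S"
    "\<And>y. y \<in> U \<Longrightarrow> \<exists>k. (\<forall>i\<ge>k. P y i = x0 \<and> R y i = \<epsilon>) \<and>
       (\<Sum>i<k. dist (P y i) (P y (Suc i)) + \<bar>R y (Suc i) - R y i\<bar>) \<le> inner_dist S x0 y + 5"
proof -
  define D where "D y = Inf (polygon_lengths S y x0)" for y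
  have ne: "polygon_lengths S y x0 \<noteq> {}" and D_le: "D y \<le> inner_dist S x0 y" if "y \<in> U" for y
    using polygon_lengths_connected[OF S U that x0] by (simp_all add: D_def)
  define good where "good y n v e \<longleftrightarrow> polygon_in S n v \<and> v 0 = y \<and> v n = x0 \<and> polygon_length n v \<le> D y + 1 \<and>
      0 < e \<and> e \<le> 1 \<and> (\<forall>i\<le>n. ball (v i) e \<subseteq> S) \<and>
      (\<forall>i<n. \<forall>x\<in>closed_segment (v i) (v (Suc i)). ball x e \<subseteq> S)" for y n v and e :: real
  have "\<exists>n v e. good y n v e" if y: "y \<in> U" for y
  proof -
    obtain L where "L \<in> polygon_lengths S y x0" "L < D y + 1"
      using cInf_lessD[OF ne[OF y], of "D y + 1"] by (auto simp: D_def)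
    then obtain n v where v: "polygon_in S n v" "v 0 = y" "v n = x0" "polygon_length n v \<le> D y + 1"
      by (auto simp: polygon_lengths_def)
    obtain e where "0 < e" "e \<le> 1" "\<And>i. i \<le> n \<Longrightarrow> ball (v i) e \<subseteq> S"
      "\<And>i x. i < n \<Longrightarrow> x \<in> closed_segment (v i) (v (Suc i)) \<Longrightarrow> ball x e \<subseteq> S"
      using polygon_thickness[OF S v(1)] by metis
    with v have "good y n v e" by (simp add: good_def)
    then show ?thesis by blast
  qed
  then obtain n v e where "\<And>y. y \<in> U \<Longrightarrow> good y (n y) (v y) (e y)" by metis
  then have v: "\<And>y. y \<in> U \<Longrightarrow> polygon_in S (n y) (v y)"
    and v0: "\<And>y. y \<in> U \<Longrightarrow> v y 0 = y" and vn: "\<And>y. y \<in> U \<Longrightarrow> v y (n y) = x0"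
    and len: "\<And>y. y \<in> U \<Longrightarrow> polygon_length (n y) (v y) \<le> D y + 1"
    and e: "\<And>y. y \<in> U \<Longrightarrow> 0 < e y" "\<And>y. y \<in> U \<Longrightarrow> e y \<le> 1"
    and th: "\<And>y i. y \<in> U \<Longrightarrow> i \<le> n y \<Longrightarrow> ball (v y i) (e y) \<subseteq> S"
      "\<And>y i x. y \<in> U \<Longrightarrow> i < n y \<Longrightarrow> x \<in> closed_segment (v y i) (v y (Suc i)) \<Longrightarrow> ball x (e y) \<subseteq> S"
    by (simp_all add: good_def)
  obtain \<epsilon> where \<epsilon>: "0 < \<epsilon>" "\<epsilon> \<le> 1" "ball x0 \<epsilon> \<subseteq> S"
    using e[OF x0] th(1)[OF x0, of 0] v0[OF x0] by auto
  obtain q :: "nat \<Rightarrow> real ^ 'n" where q: "\<And>j. q j \<in> U" and cover: "\<And>y. y \<in> U \<Longrightarrow> \<exists>j. y \<in> ball (q j) (e (q j))"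
    using countable_ball_cover[of U e] x0 e(1) by blast
  define J where "J y = (LEAST j. y \<in> ball (q j) (e (q j)))" for y
  have J: "y \<in> ball (q (J y)) (e (q (J y)))" if "y \<in> U" for y
    unfolding J_def using cover[OF that] by (rule LeastI_ex)
  have J_meas[measurable]: "J \<in> measurable borel (count_space UNIV)"
    unfolding J_def by (rule measurable_Least) (simp add: pred_def)
  define P where "P y i = (case i of 0 \<Rightarrow> y | Suc m \<Rightarrow> v (q (J y)) (min m (n (q (J y)))))" for y i
  define R where "R y i = (case i of 0 \<Rightarrow> 0 | Suc m \<Rightarrow> if m \<le> n (q (J y)) then e (q (J y)) else \<epsilon>)" for y i
  show ?thesis
  proof
    show "(\<lambda>y. P y i) \<in> borel_measurable borel" "(\<lambda>y. R y i) \<in> borel_measurable borel" for i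
      unfolding P_def R_def by (cases i; simp)+
    show "P y 0 = y" "R y 0 = 0" "0 < R y (Suc i)" for y i
      using e(1)[OF q] \<epsilon>(1) by (auto simp: P_def R_def)
    show "closed_segment (P y i + R y i *\<^sub>R z) (P y (Suc i) + R y (Suc i) *\<^sub>R z) \<subseteq> S"
      if y: "y \<in> U" and z: "norm z < 1" for y i z
    proof -
      let ?q = "q (J y)"
      note Q = q[of "J y"]
      have in_ball: "c + r *\<^sub>R z \<in> ball c r" if "0 < r" for c r
        using z that by (simp add: dist_norm)
      show ?thesis
      proof (cases i)
        case 0
        have "?q + e ?q *\<^sub>R z \<in> ball ?q (e ?q)" by (rule in_ball[OF e(1)[OF Q]])
        then have "closed_segment y (?q + e ?q *\<^sub>R z) \<subseteq> ball ?q (e ?q)"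
          by (intro closed_segment_subset J[OF y]) auto
        also have "\<dots> \<subseteq> S" using th(1)[OF Q, of 0] v0[OF Q] by simp
        finally show ?thesis by (simp add: 0 P_def R_def v0[OF Q])
      next
        case (Suc m)
        consider "m < n ?q" | "n ?q \<le> m" by linarith
        then show ?thesis
        proof cases
          case 1
          have "norm (e ?q *\<^sub>R z) < e ?q" using z e(1)[OF Q] by simp
          with th(2)[OF Q 1] have "closed_segment (v ?q m + e ?q *\<^sub>R z) (v ?q (Suc m) + e ?q *\<^sub>R z) \<subseteq> S"
            by (rule closed_segment_translate_ball)
          with 1 show ?thesis by (simp add: Suc P_def R_def min_def)
        next
          case 2
          define M where "M = max (e ?q) \<epsilon>"
          have M: "ball x0 M \<subseteq> S" using th(1)[OF Q, of "n ?q"] vn[OF Q] \<epsilon>(3) by (simp add: M_def max_def)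
          have "x0 + R y j *\<^sub>R z \<in> ball x0 M" if "j > 0" for j
          proof -
            have "0 < R y j" "R y j \<le> M"
              using that e(1)[OF Q] \<epsilon>(1) by (auto simp: R_def M_def split: nat.split)
            then show ?thesis using in_ball[of "R y j" x0] subset_ball[of "R y j" M x0] by auto
          qed
          then have "closed_segment (x0 + R y i *\<^sub>R z) (x0 + R y (Suc i) *\<^sub>R z) \<subseteq> ball x0 M"
            by (intro closed_segment_subset convex_ball) (simp_all add: Suc)
          with M have "closed_segment (x0 + R y i *\<^sub>R z) (x0 + R y (Suc i) *\<^sub>R z) \<subseteq> S"
            by blast
          moreover have "P y i = x0" "P y (Suc i) = x0" using 2 vn[OF Q] by (simp_all add: Suc P_def min_def)
          ultimately show ?thesis by simp
        qed
      qed
    qed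
    show "\<exists>k. (\<forall>i\<ge>k. P y i = x0 \<and> R y i = \<epsilon>) \<and>
       (\<Sum>i<k. dist (P y i) (P y (Suc i)) + \<bar>R y (Suc i) - R y i\<bar>) \<le> inner_dist S x0 y + 5"
      if y: "y \<in> U" for y
    proof (intro exI conjI)
      let ?q = "q (J y)"
      note Q = q[of "J y"]
      show "\<forall>i\<ge>n ?q + 2. P y i = x0 \<and> R y i = \<epsilon>"
        using vn[OF Q] by (auto simp: P_def R_def split: nat.split)
      have close: "dist y ?q \<le> 1" using J[OF y] e(2)[OF Q] by (simp add: dist_commute)
      have "closed_segment ?q y \<subseteq> ball ?q (e ?q)"
        using J[OF y] e(1)[OF Q] by (intro closed_segment_subset) auto
      also have "\<dots> \<subseteq> S" using th(1)[OF Q, of 0] v0[OF Q] by simp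
      finally have Dq: "D ?q \<le> 1 + D y"
        using Inf_polygon_lengths_le[OF ne[OF y], of ?q] close by (simp add: D_def dist_commute)
      have mid: "(\<Sum>m<n ?q. dist (P y (Suc m)) (P y (Suc (Suc m))) + \<bar>R y (Suc (Suc m)) - R y (Suc m)\<bar>)
          = polygon_length (n ?q) (v ?q)"
        unfolding polygon_length_def by (intro sum.cong) (auto simp: P_def R_def min_def)
      have first: "dist (P y 0) (P y (Suc 0)) + \<bar>R y (Suc 0) - R y 0\<bar> \<le> 2"
        using close e[OF Q] by (simp add: P_def R_def v0[OF Q])
      have last: "dist (P y (Suc (n ?q))) (P y (Suc (Suc (n ?q))))
          + \<bar>R y (Suc (Suc (n ?q))) - R y (Suc (n ?q))\<bar> \<le> 1"
        using e[OF Q] \<epsilon> by (simp add: P_def R_def min_def abs_le_iff)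
      have "(\<Sum>i<n ?q + 2. dist (P y i) (P y (Suc i)) + \<bar>R y (Suc i) - R y i\<bar>)
          = (dist (P y 0) (P y (Suc 0)) + \<bar>R y (Suc 0) - R y 0\<bar>) + polygon_length (n ?q) (v ?q)
            + (dist (P y (Suc (n ?q))) (P y (Suc (Suc (n ?q)))) + \<bar>R y (Suc (Suc (n ?q))) - R y (Suc (n ?q))\<bar>)"
        unfolding add_2_eq_Suc' mid[symmetric]
        by (subst sum.lessThan_Suc, subst sum.lessThan_Suc_shift) (rule refl)
      also have "\<dots> \<le> 2 + (D ?q + 1) + 1" using first last len[OF Q] by linarith
      also have "\<dots> \<le> inner_dist S x0 y + 5" using Dq D_le[OF y] by simp
      finally show "(\<Sum>i<n ?q + 2. dist (P y i) (P y (Suc i)) + \<bar>R y (Suc i) - R y i\<bar>)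
          \<le> inner_dist S x0 y + 5" .
    qed
  qed
qed

section \<open>Laws of the offset and of the time\<close>

definition ball_law :: "'a::euclidean_space measure" where
  "ball_law = uniform_measure lborel (ball 0 1)"

text \<open>A density rather than a restriction of Lebesgue measure, so that the measurable sets are
  those of the whole line.\<close>

definition interval_law :: "real measure" where
  "interval_law = density lborel (\<lambda>t. ennreal (indicator {0..1} t))"

lemma sets_ball_law [simp, measurable_cong]: "sets ball_law = sets borel"
  and space_ball_law [simp]: "space ball_law = UNIV"
  by (simp_all add: ball_law_def)

lemma sets_interval_law [simp, measurable_cong]: "sets interval_law = sets borel"
  and space_interval_law [simp]: "space interval_law = UNIV"
  by (simp_all add: interval_law_def)

lemma emeasure_ball_pos_finite:
  "emeasure lborel (ball (0::'a::euclidean_space) 1) \<noteq> 0" "emeasure lborel (ball (0::'a) 1) \<noteq> \<infinity>"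
proof -
  show "emeasure lborel (ball (0::'a) 1) \<noteq> \<infinity>"
    using emeasure_bounded_finite[of "ball (0::'a) 1"] by auto
  have "negligible (ball (0::'a) 1) \<longleftrightarrow> False"
    using open_not_negligible[of "ball (0::'a) 1"] by auto
  then show "emeasure lborel (ball (0::'a) 1) \<noteq> 0"
    by (auto simp: negligible_iff_null_sets null_sets_def)
qed

lemma emeasure_ball_law: "emeasure (ball_law :: 'a::euclidean_space measure) UNIV = 1"
proof -
  have "emeasure (ball_law :: 'a measure) UNIV = emeasure lborel (ball (0::'a) 1) / emeasure lborel (ball (0::'a) 1)"
    by (simp add: ball_law_def)
  also have "\<dots> = 1"
    using emeasure_ball_pos_finite[where 'a='a] by (intro ennreal_divide_self) (auto simp: less_top)
  finally show ?thesis .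
qed

lemma AE_ball_law: "AE z in ball_law. norm z < 1"
  unfolding ball_law_def by (rule AE_uniform_measureI) auto

lemma AE_ball_lawI: "AE z in lborel. Q z \<Longrightarrow> AE z in ball_law. Q z"
  unfolding ball_law_def by (rule AE_uniform_measureI) auto

lemma emeasure_interval_law: "emeasure interval_law UNIV = 1"
  by (simp add: interval_law_def emeasure_density ennreal_indicator)

lemma AE_interval_law: "AE t in interval_law. 0 < t \<and> t \<le> 1"
proof -
  have "AE t::real in lborel. t \<noteq> 0" by (rule AE_lborel_singleton)
  then show ?thesis unfolding interval_law_def
    by (subst AE_density) (auto simp: indicator_def elim!: eventually_mono)
qed

lemma finite_measure_laws: "finite_measure (ball_law :: 'a::euclidean_space measure)" "finite_measure interval_law"
  by (auto intro!: finite_measureI simp: emeasure_ball_law emeasure_interval_law)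

lemma AE_lborel_affine_not_in_null:
  fixes N :: "'a::euclidean_space set"
  assumes N: "N \<in> null_sets lborel" and s: "s \<noteq> 0"
  shows "AE z in lborel. c + s *\<^sub>R z \<notin> N"
proof -
  have [measurable]: "N \<in> sets borel" using N by auto
  have "0 = emeasure (density (distr lborel borel (\<lambda>x. c + s *\<^sub>R x)) (\<lambda>_. \<bar>s\<bar> ^ DIM('a))) N"
    using N lborel_affine[OF s, of c] by auto
  also have "\<dots> = \<bar>s\<bar> ^ DIM('a) * emeasure lborel ((\<lambda>x. c + s *\<^sub>R x) -` N)"
    by (simp add: emeasure_density nn_integral_cmult_indicator emeasure_distr)
  finally have "emeasure lborel ((\<lambda>x. c + s *\<^sub>R x) -` N) = 0" using s by simp
  then have "(\<lambda>x. c + s *\<^sub>R x) -` N \<in> null_sets lborel"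
    by (auto simp: null_sets_def intro!: measurable_sets_borel[of _ borel])
  then show ?thesis by (auto dest: AE_not_in)
qed

section \<open>Test functions along segments\<close>

lemma has_derivative_gradient:
  fixes \<phi> :: "real ^ 'n \<Rightarrow> real"
  assumes "\<phi> differentiable (at x)"
  shows "(\<phi> has_derivative (\<lambda>v. v \<bullet> gradient \<phi> x)) (at x)"
proof -
  have D: "(\<phi> has_derivative frechet_derivative \<phi> (at x)) (at x)"
    using assms by (simp add: frechet_derivative_works)
  then have lin: "linear (frechet_derivative \<phi> (at x))" by (rule has_derivative_linear)
  have "frechet_derivative \<phi> (at x) v = v \<bullet> gradient \<phi> x" for v
  proof -
    have "frechet_derivative \<phi> (at x) v = frechet_derivative \<phi> (at x) (\<Sum>i\<in>UNIV. (v $ i) *\<^sub>R axis i 1)"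
      by (simp add: basis_expansion flip: scalar_mult_eq_scaleR)
    also have "\<dots> = (\<Sum>i\<in>UNIV. v $ i * partial_deriv i \<phi> x)"
      by (simp add: linear_sum[OF lin] linear_cmul[OF lin] partial_deriv_def)
    finally show ?thesis by (simp add: gradient_def inner_vec_def)
  qed
  then have "frechet_derivative \<phi> (at x) = (\<lambda>v. v \<bullet> gradient \<phi> x)" by (rule ext)
  with D show ?thesis by simp
qed

lemma test_function_gradient:
  assumes "test_function \<phi>"
  shows "\<phi> differentiable (at x)" and "continuous_on UNIV \<phi>" and "continuous_on UNIV (gradient \<phi>)"
    and "\<exists>B. \<forall>x. \<bar>\<phi> x\<bar> \<le> B" and "\<exists>B. \<forall>x. norm (gradient \<phi> x) \<le> B"
proof -
  have k: "k_times_cont_diff (Suc 0) \<phi>" "k_times_cont_diff 0 \<phi>"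
    using assms unfolding test_function_def by blast+
  show d: "\<phi> differentiable (at x)" for x using k by simp
  show c: "continuous_on UNIV \<phi>" using k by simp
  show cg: "continuous_on UNIV (gradient \<phi>)"
    unfolding gradient_def using k(1) by (intro continuous_on_vec_lambda) simp
  define K where "K = closure {x. \<phi> x \<noteq> 0}"
  have K: "compact K" using assms by (simp add: test_function_def K_def)
  have z: "\<phi> x = 0" if "x \<notin> K" for x using that closure_subset[of "{x. \<phi> x \<noteq> 0}"] by (auto simp: K_def)
  have gz: "gradient \<phi> x = 0" if x: "x \<notin> K" for x
  proof -
    have "((\<lambda>_. 0) has_derivative (\<lambda>v. v \<bullet> gradient \<phi> x)) (at x)"
      by (rule has_derivative_transform_within_open[OF has_derivative_gradient[OF d], of "- K"])
         (use K x z in \<open>auto simp: compact_imp_closed\<close>)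
    then have "(\<lambda>v. v \<bullet> gradient \<phi> x) = (\<lambda>_. 0)"
      by (rule has_derivative_unique) simp
    from fun_cong[OF this, of "gradient \<phi> x"] show ?thesis by simp
  qed
  have "bounded (\<phi> ` K)" "bounded (gradient \<phi> ` K)"
    using c cg K by (auto intro!: compact_imp_bounded compact_continuous_image elim: continuous_on_subset)
  then obtain B B' where B: "\<And>x. x \<in> K \<Longrightarrow> \<bar>\<phi> x\<bar> \<le> B" and B': "\<And>x. x \<in> K \<Longrightarrow> norm (gradient \<phi> x) \<le> B'"
    unfolding bounded_iff real_norm_def by blast
  have "\<forall>x. \<bar>\<phi> x\<bar> \<le> max B 0"
  proof
    fix x show "\<bar>\<phi> x\<bar> \<le> max B 0" using B[of x] z[of x] by (cases "x \<in> K") auto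
  qed
  then show "\<exists>B. \<forall>x. \<bar>\<phi> x\<bar> \<le> B" by blast
  have "\<forall>x. norm (gradient \<phi> x) \<le> max B' 0"
  proof
    fix x show "norm (gradient \<phi> x) \<le> max B' 0" using B'[of x] gz[of x] by (cases "x \<in> K") auto
  qed
  then show "\<exists>B. \<forall>x. norm (gradient \<phi> x) \<le> B" by blast
qed

text \<open>The fundamental theorem of calculus for \<open>\<phi>\<close> along the segment from \<open>a\<close> to \<open>b\<close>.\<close>

lemma integral_gradient_segment:
  fixes \<phi> :: "real ^ 'n \<Rightarrow> real"
  assumes d: "\<And>x. \<phi> differentiable (at x)" and cg: "continuous_on UNIV (gradient \<phi>)"
  shows "(LINT t|interval_law. (b - a) \<bullet> gradient \<phi> ((1 - t) *\<^sub>R a + t *\<^sub>R b)) = \<phi> b - \<phi> a"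
proof -
  let ?c = "\<lambda>t::real. (1 - t) *\<^sub>R a + t *\<^sub>R b"
  have cont: "continuous_on UNIV (\<lambda>t. (b - a) \<bullet> gradient \<phi> (?c t))"
    by (intro continuous_intros continuous_on_compose2[OF cg]) auto
  have der: "((\<lambda>t. \<phi> (?c t)) has_vector_derivative (b - a) \<bullet> gradient \<phi> (?c t)) (at t within T)" for t T
  proof -
    have c: "(?c has_derivative (\<lambda>h. h *\<^sub>R (b - a))) (at t within T)"
      by (auto intro!: derivative_eq_intros simp: algebra_simps)
    show ?thesis
      using has_derivative_compose[OF c has_derivative_gradient[OF d]]
      by (simp add: has_vector_derivative_def)
  qed
  have "(LINT t|interval_law. (b - a) \<bullet> gradient \<phi> (?c t))
      = (LINT t|lborel. indicator {0..1} t *\<^sub>R ((b - a) \<bullet> gradient \<phi> (?c t)))"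
    unfolding interval_law_def
    using borel_measurable_continuous_onI[OF cont] by (intro integral_density) auto
  also have "\<dots> = \<phi> (?c 1) - \<phi> (?c 0)"
    by (rule integral_FTC_atLeastAtMost[OF _ der]) (use cont in \<open>auto elim: continuous_on_subset\<close>)
  finally show ?thesis by simp
qed

section \<open>Transport along fattened polygons\<close>

text \<open>The data of a transport: \<open>M\<close> is the initial mass, \<open>P y\<close> and \<open>R y\<close> are the centres and radii through
  which a particle from \<open>y\<close> travels, and \<open>len y\<close> bounds the distance that it covers.\<close>

locale fattened_transport =
  fixes M :: "(real ^ 'n) measure" and \<Omega> S :: "(real ^ 'n) set" and x0 :: "real ^ 'n" and \<epsilon> :: real
    and P :: "real ^ 'n \<Rightarrow> nat \<Rightarrow> real ^ 'n" and R :: "real ^ 'n \<Rightarrow> nat \<Rightarrow> real"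
    and len :: "real ^ 'n \<Rightarrow> real"
  assumes sets_M: "sets M = borel_in \<Omega>" and finite_M: "finite_measure M"
    and open_S: "open S" and open_\<Omega>: "open \<Omega>" and AE_S_\<Omega>: "AE x in lborel. x \<in> S \<longrightarrow> x \<in> \<Omega>"
    and P_meas: "(\<lambda>y. P y i) \<in> borel_measurable borel" and R_meas: "(\<lambda>y. R y i) \<in> borel_measurable borel"
    and P_0: "P y 0 = y" and R_0: "R y 0 = 0" and R_pos: "0 < R y (Suc i)"
    and in_S: "y \<in> \<Omega> \<Longrightarrow> norm z < 1 \<Longrightarrow>
       closed_segment (P y i + R y i *\<^sub>R z) (P y (Suc i) + R y (Suc i) *\<^sub>R z) \<subseteq> S"
    and len: "y \<in> \<Omega> \<Longrightarrow> \<exists>k. (\<forall>i\<ge>k. P y i = x0 \<and> R y i = \<epsilon>) \<and>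
       (\<Sum>i<k. dist (P y i) (P y (Suc i)) + \<bar>R y (Suc i) - R y i\<bar>) \<le> len y"
    and len_int: "integrable M len"
begin

definition vertex :: "real ^ 'n \<Rightarrow> nat \<Rightarrow> real ^ 'n \<Rightarrow> real ^ 'n" where
  "vertex y i z = P y i + R y i *\<^sub>R z"

text \<open>A point \<open>(y, i, t, z)\<close> stands for the particle from \<open>y\<close> with offset \<open>z\<close> at time \<open>t\<close> of its \<open>i\<close>-th leg; \<open>X\<close>
  is its position and \<open>V\<close> its velocity.\<close>

definition X :: "(real ^ 'n) \<times> nat \<times> real \<times> (real ^ 'n) \<Rightarrow> real ^ 'n" where
  "X = (\<lambda>(y, i, t, z). (1 - t) *\<^sub>R vertex y i z + t *\<^sub>R vertex y (Suc i) z)"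

definition V :: "(real ^ 'n) \<times> nat \<times> real \<times> (real ^ 'n) \<Rightarrow> real ^ 'n" where
  "V = (\<lambda>(y, i, t, z). vertex y (Suc i) z - vertex y i z)"

text \<open>The legs are counted by an infinite measure; the velocity vanishes on all but finitely many of
  them. The offset comes last in the product, so that it is integrated first: this is the
  variable in which \<open>X\<close> is nonsingular.\<close>

definition L :: "(nat \<times> real \<times> (real ^ 'n)) measure" where
  "L = count_space UNIV \<Otimes>\<^sub>M (interval_law \<Otimes>\<^sub>M ball_law)"

definition Q :: "((real ^ 'n) \<times> nat \<times> real \<times> (real ^ 'n)) measure" where
  "Q = M \<Otimes>\<^sub>M L"

lemma space_M: "space M = \<Omega>"
  using sets_eq_imp_space_eq[OF sets_M] by (simp add: space_restrict_space)

lemma measurable_M: "f \<in> measurable borel N \<Longrightarrow> f \<in> measurable M N"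
  using measurable_restrict_space1[of f borel N \<Omega>] unfolding measurable_cong_sets[OF sets_M refl] .

lemma pair_TZ: "pair_sigma_finite interval_law (ball_law :: (real ^ 'n) measure)"
  using finite_measure_laws(1)[where 'a="real ^ 'n"] finite_measure_laws(2)
  by (simp add: pair_sigma_finite_def finite_measure_def)

lemma sigma_finite_TZ: "sigma_finite_measure (interval_law \<Otimes>\<^sub>M (ball_law :: (real ^ 'n) measure))"
  using pair_TZ unfolding pair_sigma_finite_def by (elim conjE) (rule sigma_finite_pair_measure)

lemma pair_C_TZ: "pair_sigma_finite (count_space (UNIV :: nat set)) (interval_law \<Otimes>\<^sub>M (ball_law :: (real ^ 'n) measure))"
  using sigma_finite_TZ sigma_finite_measure_count_space_countable[of "UNIV :: nat set"]
  by (simp add: pair_sigma_finite_def)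

lemma sigma_finite_L: "sigma_finite_measure L"
  unfolding L_def using pair_C_TZ unfolding pair_sigma_finite_def
  by (elim conjE) (rule sigma_finite_pair_measure)

lemma pair_M_L: "pair_sigma_finite M L"
  using sigma_finite_L finite_M by (simp add: pair_sigma_finite_def finite_measure_def)

lemma measurable_vertex:
  "(\<lambda>q. vertex (fst q) (fst (snd q)) (snd (snd (snd q)))) \<in> borel_measurable Q"
  "(\<lambda>q. vertex (fst q) (Suc (fst (snd q))) (snd (snd (snd q)))) \<in> borel_measurable Q"
proof -
  have *: "(\<lambda>q. vertex (fst q) (i + fst (snd q)) (snd (snd (snd q)))) \<in> borel_measurable Q" for i
  proof (rule measurable_compose_countable[where g="\<lambda>q. fst (snd q)"])
    have PR: "(\<lambda>q. P (fst q) j) \<in> borel_measurable Q" "(\<lambda>q. R (fst q) j) \<in> borel_measurable Q" for j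
      unfolding Q_def by (rule measurable_compose[OF measurable_fst measurable_M[OF P_meas]]
        measurable_compose[OF measurable_fst measurable_M[OF R_meas]])+
    have z: "(\<lambda>q. snd (snd (snd q))) \<in> borel_measurable Q"
      unfolding Q_def L_def by measurable
    show "(\<lambda>q. vertex (fst q) (i + j) (snd (snd (snd q)))) \<in> borel_measurable Q" for j
      unfolding vertex_def by (intro borel_measurable_add borel_measurable_scaleR PR z)
    show "(\<lambda>q. fst (snd q)) \<in> measurable Q (count_space UNIV)"
      unfolding Q_def L_def by measurable
  qed
  from *[of 0] *[of 1] show
    "(\<lambda>q. vertex (fst q) (fst (snd q)) (snd (snd (snd q)))) \<in> borel_measurable Q"
    "(\<lambda>q. vertex (fst q) (Suc (fst (snd q))) (snd (snd (snd q)))) \<in> borel_measurable Q"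
    by (simp_all only: add_0 plus_1_eq_Suc)
qed

lemma measurable_X [measurable]: "X \<in> borel_measurable Q"
proof -
  have t: "(\<lambda>q. fst (snd (snd q))) \<in> borel_measurable Q"
    unfolding Q_def L_def by measurable
  show ?thesis unfolding X_def case_prod_beta'
    by (intro borel_measurable_add borel_measurable_scaleR borel_measurable_diff borel_measurable_const t measurable_vertex)
qed

lemma measurable_V [measurable]: "V \<in> borel_measurable Q"
  unfolding V_def case_prod_beta' by (intro borel_measurable_diff measurable_vertex)

lemma measurable_section:
  assumes f: "f \<in> measurable Q N" and y: "y \<in> \<Omega>"
  shows "(\<lambda>l. f (y, l)) \<in> measurable L N"
  using measurable_compose[OF measurable_Pair1'[of y M L] f[unfolded Q_def]] y by (simp add: space_M)

lemma AE_Q_I: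
  assumes meas: "Measurable.pred Q Pr"
    and ae: "\<And>y i. y \<in> \<Omega> \<Longrightarrow> AE t in interval_law. AE z in ball_law. Pr (y, i, t, z)"
  shows "AE q in Q. Pr q"
proof -
  interpret M_L: pair_sigma_finite M L by (rule pair_M_L)
  interpret CTZ: pair_sigma_finite "count_space (UNIV :: nat set)" "interval_law \<Otimes>\<^sub>M (ball_law :: (real ^ 'n) measure)"
    by (rule pair_C_TZ)
  interpret TZ: pair_sigma_finite interval_law "ball_law :: (real ^ 'n) measure" by (rule pair_TZ)
  have "AE l in L. Pr (y, l)" if y: "y \<in> \<Omega>" for y
  proof -
    have m1: "Measurable.pred L (\<lambda>l. Pr (y, l))" by (rule measurable_section[OF meas y])
    have m2: "Measurable.pred (interval_law \<Otimes>\<^sub>M ball_law) (\<lambda>tz. Pr (y, i, tz))" for i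
      using measurable_compose[OF measurable_Pair1'[of i "count_space UNIV"] m1[unfolded L_def]] by simp
    have "AE tz in interval_law \<Otimes>\<^sub>M ball_law. Pr (y, i, tz)" for i
      using m2[of i] ae[OF y] by (intro TZ.AE_pair_measure) (simp_all add: pred_def)
    then show ?thesis
      unfolding L_def using m1 by (intro CTZ.AE_pair_measure) (simp_all add: pred_def L_def AE_count_space)
  qed
  then have "AE y in M. AE l in L. Pr (y, l)" by (rule AE_I2) (simp add: space_M)
  then show ?thesis
    unfolding Q_def using meas by (intro M_L.AE_pair_measure) (simp_all add: pred_def Q_def)
qed

lemma R_convex_pos:
  assumes "0 < t" "t \<le> 1"
  shows "0 < (1 - t) * R y i + t * R y (Suc i)"
proof -
  have "0 \<le> R y i" using R_0[of y] R_pos[of y "i - 1"] by (cases i) auto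
  then show ?thesis using assms R_pos[of y i] by (intro add_nonneg_pos) auto
qed

text \<open>For fixed \<open>y\<close>, \<open>i\<close> and \<open>t > 0\<close> the position is an affine function of the offset with positive
  ratio, even on the first leg, where the radius starts from \<open>0\<close>.\<close>

lemma AE_X_not_in_null:
  assumes N: "N \<in> null_sets lborel"
  shows "AE q in Q. X q \<notin> N"
proof (rule AE_Q_I)
  have [measurable]: "N \<in> sets borel" using N by auto
  show "Measurable.pred Q (\<lambda>q. X q \<notin> N)" by measurable
  fix y i
  show "AE t in interval_law. AE z in ball_law. X (y, i, t, z) \<notin> N"
    using AE_interval_law
  proof eventually_elim
    case (elim t)
    have eq: "X (y, i, t, z) = ((1 - t) *\<^sub>R P y i + t *\<^sub>R P y (Suc i)) + ((1 - t) * R y i + t * R y (Suc i)) *\<^sub>R z" for z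
      by (simp add: X_def vertex_def algebra_simps)
    show ?case
      unfolding eq using elim R_convex_pos[of t y i]
      by (intro AE_ball_lawI AE_lborel_affine_not_in_null[OF N]) auto
  qed
qed

text \<open>The motion takes place in \<open>S\<close>, and it avoids the null set \<open>S - \<Omega>\<close> almost surely.\<close>

lemma AE_X_in_\<Omega>: "AE q in Q. X q \<in> \<Omega>"
proof -
  have "AE q in Q. X q \<in> S"
  proof (rule AE_Q_I)
    have [measurable]: "S \<in> sets borel" using open_S by auto
    show "Measurable.pred Q (\<lambda>q. X q \<in> S)" by measurable
    fix y i assume y: "y \<in> \<Omega>"
    show "AE t in interval_law. AE z in ball_law. X (y, i, t, z) \<in> S"
      using AE_interval_law
    proof eventually_elim
      case t: (elim t)
      show ?case
        using AE_ball_law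
      proof eventually_elim
        case (elim z)
        have "X (y, i, t, z) \<in> closed_segment (vertex y i z) (vertex y (Suc i) z)"
          using t by (auto simp: X_def in_segment intro!: exI[of _ t])
        then show ?case using in_S[OF y elim, of i] by (auto simp: vertex_def)
      qed
    qed
  qed
  moreover have "S - \<Omega> \<in> null_sets lborel"
    using AE_S_\<Omega> open_S open_\<Omega> by (subst AE_iff_null_sets) auto
  then have "AE q in Q. X q \<notin> S - \<Omega>" by (rule AE_X_not_in_null)
  ultimately show ?thesis by eventually_elim auto
qed

lemma norm_V_le:
  assumes "norm z < 1"
  shows "norm (V (y, i, t, z)) \<le> dist (P y i) (P y (Suc i)) + \<bar>R y (Suc i) - R y i\<bar>"
proof -
  have "V (y, i, t, z) = (P y (Suc i) - P y i) + (R y (Suc i) - R y i) *\<^sub>R z"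
    by (simp add: V_def vertex_def algebra_simps)
  also have "norm \<dots> \<le> norm (P y (Suc i) - P y i) + norm ((R y (Suc i) - R y i) *\<^sub>R z)"
    by (rule norm_triangle_ineq)
  also have "norm ((R y (Suc i) - R y i) *\<^sub>R z) \<le> \<bar>R y (Suc i) - R y i\<bar> * 1"
    unfolding norm_scaleR using assms by (intro mult_left_mono) auto
  finally show ?thesis by (simp add: dist_norm norm_minus_commute)
qed

lemma nn_integral_V_section:
  assumes y: "y \<in> \<Omega>"
  shows "(\<integral>\<^sup>+l. norm (V (y, l)) \<partial>L) \<le> ennreal (len y)"
proof -
  interpret Z: finite_measure "ball_law :: (real ^ 'n) measure" by (rule finite_measure_laws)
  interpret TZ: sigma_finite_measure "interval_law \<Otimes>\<^sub>M (ball_law :: (real ^ 'n) measure)" by (rule sigma_finite_TZ)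
  define l where "l i = dist (P y i) (P y (Suc i)) + \<bar>R y (Suc i) - R y i\<bar>" for i
  obtain k where k: "\<And>i. i \<ge> k \<Longrightarrow> P y i = x0 \<and> R y i = \<epsilon>" and le: "sum l {..<k} \<le> len y"
    using len[OF y] by (auto simp: l_def)
  have m1[measurable]: "(\<lambda>l. ennreal (norm (V (y, l)))) \<in> borel_measurable L"
    by (rule measurable_section[OF _ y, of "\<lambda>q. ennreal (norm (V q))"]) measurable
  have m2[measurable]: "(\<lambda>tz. ennreal (norm (V (y, i, tz)))) \<in> borel_measurable (interval_law \<Otimes>\<^sub>M ball_law)" for i
    using measurable_compose[OF measurable_Pair1'[of i "count_space UNIV"] m1[unfolded L_def]] by simp
  have inner: "(\<integral>\<^sup>+tz. norm (V (y, i, tz)) \<partial>(interval_law \<Otimes>\<^sub>M ball_law)) \<le> ennreal (l i)" for i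
  proof -
    have "(\<integral>\<^sup>+tz. norm (V (y, i, tz)) \<partial>(interval_law \<Otimes>\<^sub>M ball_law))
        = (\<integral>\<^sup>+t. \<integral>\<^sup>+z. norm (V (y, i, t, z)) \<partial>ball_law \<partial>interval_law)"
      by (rule Z.nn_integral_fst[symmetric]) measurable
    also have "\<dots> \<le> (\<integral>\<^sup>+t. \<integral>\<^sup>+z. ennreal (l i) \<partial>(ball_law :: (real ^ 'n) measure) \<partial>interval_law)"
    proof (rule nn_integral_mono, rule nn_integral_mono_AE)
      fix t :: real
      show "AE z in ball_law. ennreal (norm (V (y, i, t, z))) \<le> ennreal (l i)"
        unfolding l_def using AE_ball_law by eventually_elim (rule ennreal_leI[OF norm_V_le])
    qed
    also have "\<dots> = ennreal (l i)"
      by (simp add: emeasure_ball_law emeasure_interval_law)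
    finally show ?thesis .
  qed
  have "(\<integral>\<^sup>+l. norm (V (y, l)) \<partial>L) = (\<integral>\<^sup>+i. \<integral>\<^sup>+tz. norm (V (y, i, tz)) \<partial>(interval_law \<Otimes>\<^sub>M ball_law) \<partial>count_space UNIV)"
    unfolding L_def by (rule TZ.nn_integral_fst[symmetric]) (use m1 in \<open>simp add: L_def\<close>)
  also have "\<dots> \<le> (\<integral>\<^sup>+i. ennreal (l i) \<partial>count_space UNIV)"
    by (intro nn_integral_mono inner)
  also have "\<dots> = (\<Sum>i. ennreal (l i))" by (rule nn_integral_count_space_nat)
  also have "\<dots> = (\<Sum>i<k. ennreal (l i))"
    using k by (intro suminf_finite) (auto simp: l_def not_less)
  also have "\<dots> = ennreal (sum l {..<k})" by (rule sum_ennreal) (simp add: l_def)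
  also have "\<dots> \<le> ennreal (len y)" by (rule ennreal_leI[OF le])
  finally show ?thesis .
qed

lemma integrable_norm_V: "integrable Q (\<lambda>q. norm (V q))"
proof (rule integrableI_bounded)
  interpret L: sigma_finite_measure L by (rule sigma_finite_L)
  have "(\<integral>\<^sup>+q. ennreal (norm (norm (V q))) \<partial>Q) = (\<integral>\<^sup>+y. \<integral>\<^sup>+l. norm (V (y, l)) \<partial>L \<partial>M)"
    unfolding Q_def real_norm_def abs_norm_cancel by (rule L.nn_integral_fst[symmetric]) (simp add: Q_def[symmetric])
  also have "\<dots> \<le> (\<integral>\<^sup>+y. ennreal (len y) \<partial>M)"
    by (intro nn_integral_mono nn_integral_V_section) (simp add: space_M)
  also have "\<dots> \<le> (\<integral>\<^sup>+y. ennreal (norm (len y)) \<partial>M)"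
    by (intro nn_integral_mono ennreal_leI) simp
  also have "\<dots> < \<infinity>" using len_int by (simp add: integrable_iff_bounded)
  finally show "(\<integral>\<^sup>+q. ennreal (norm (norm (V q))) \<partial>Q) < \<infinity>" .
qed measurable

lemma integrable_V_section:
  assumes y: "y \<in> \<Omega>"
  shows "integrable L (\<lambda>l. norm (V (y, l)))"
proof (rule integrableI_bounded)
  show "(\<lambda>l. norm (V (y, l))) \<in> borel_measurable L"
    by (rule measurable_section[OF measurable_compose[OF measurable_V borel_measurable_norm] y])
  show "(\<integral>\<^sup>+l. ennreal (norm (norm (V (y, l)))) \<partial>L) < \<infinity>"
    unfolding real_norm_def abs_norm_cancel
    by (rule le_less_trans[OF nn_integral_V_section[OF y]]) simp
qed

text \<open>On each leg, integrating over time first gives the increment of \<open>\<phi>\<close>; the means of \<open>\<phi>\<close> over the offset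
  telescope from \<open>\<phi> y\<close> to the mean around \<open>x0\<close>, which does not depend on \<open>y\<close>.\<close>

lemma integral_gradient_section:
  assumes \<phi>: "test_function \<phi>" and y: "y \<in> \<Omega>"
  shows "integrable L (\<lambda>l. V (y, l) \<bullet> gradient \<phi> (X (y, l)))"
    and "(LINT l|L. V (y, l) \<bullet> gradient \<phi> (X (y, l))) = (LINT z|ball_law. \<phi> (x0 + \<epsilon> *\<^sub>R z)) - \<phi> y"
proof -
  note d = test_function_gradient(1)[OF \<phi>] and c\<phi> = test_function_gradient(2)[OF \<phi>]
    and cg = test_function_gradient(3)[OF \<phi>]
  have gm[measurable]: "gradient \<phi> \<in> borel_measurable borel" and \<phi>m[measurable]: "\<phi> \<in> borel_measurable borel"
    using cg c\<phi> by (auto intro: borel_measurable_continuous_onI)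
  obtain B where B: "\<And>x. norm (gradient \<phi> x) \<le> B" using test_function_gradient(5)[OF \<phi>] by blast
  obtain B\<phi> where B\<phi>: "\<And>x. \<bar>\<phi> x\<bar> \<le> B\<phi>" using test_function_gradient(4)[OF \<phi>] by blast
  define f where "f l = V (y, l) \<bullet> gradient \<phi> (X (y, l))" for l
  have fm: "f \<in> borel_measurable L"
    unfolding f_def by (rule measurable_section[OF _ y, of "\<lambda>q. V q \<bullet> gradient \<phi> (X q)"]) measurable
  have fi: "integrable L f"
  proof (rule Bochner_Integration.integrable_bound[OF integrable_mult_left[OF integrable_V_section[OF y], of B] fm])
    show "AE l in L. norm (f l) \<le> norm (norm (V (y, l)) * B)"
    proof (rule AE_I2)
      fix l
      have "norm (f l) \<le> norm (V (y, l)) * norm (gradient \<phi> (X (y, l)))"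
        unfolding f_def real_norm_def by (rule Cauchy_Schwarz_ineq2)
      also have "\<dots> \<le> norm (V (y, l)) * B" by (intro mult_left_mono B) simp
      also have "\<dots> \<le> norm (norm (V (y, l)) * B)" by simp
      finally show "norm (f l) \<le> norm (norm (V (y, l)) * B)" .
    qed
  qed
  then show "integrable L (\<lambda>l. V (y, l) \<bullet> gradient \<phi> (X (y, l)))" by (simp add: f_def[abs_def])
  interpret CTZ: pair_sigma_finite "count_space (UNIV :: nat set)" "interval_law \<Otimes>\<^sub>M (ball_law :: (real ^ 'n) measure)"
    by (rule pair_C_TZ)
  interpret TZ: pair_sigma_finite interval_law "ball_law :: (real ^ 'n) measure" by (rule pair_TZ)
  interpret Z: finite_measure "ball_law :: (real ^ 'n) measure" by (rule finite_measure_laws)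
  define m where "m i = (LINT z|ball_law. \<phi> (vertex y i z))" for i
  have vm: "(\<lambda>z. vertex y i z) \<in> borel_measurable ball_law" for i
    unfolding vertex_def by measurable
  have \<phi>i: "integrable ball_law (\<lambda>z. \<phi> (vertex y i z))" for i
    by (rule Z.integrable_const_bound[of _ B\<phi>]) (use B\<phi> measurable_compose[OF vm \<phi>m] in auto)
  have step: "(LINT tz|(interval_law \<Otimes>\<^sub>M ball_law). f (i, tz)) = m (Suc i) - m i" for i
  proof -
    have "integrable (interval_law \<Otimes>\<^sub>M ball_law) (\<lambda>tz. f (i, tz))"
      using CTZ.AE_integrable_fst'[OF fi[unfolded L_def]] by (simp add: AE_count_space)
    then have "integrable (interval_law \<Otimes>\<^sub>M ball_law) (case_prod (\<lambda>t z. f (i, t, z)))"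
      by (simp add: case_prod_beta')
    from TZ.integral_fst'[OF this] TZ.Fubini_integral[OF this]
    have "(LINT tz|(interval_law \<Otimes>\<^sub>M ball_law). f (i, tz)) = (LINT z|ball_law. LINT t|interval_law. f (i, t, z))"
      by (simp add: case_prod_beta')
    also have "(\<lambda>z. LINT t|interval_law. f (i, t, z)) = (\<lambda>z. \<phi> (vertex y (Suc i) z) - \<phi> (vertex y i z))"
      using integral_gradient_segment[OF d cg] by (simp add: f_def V_def X_def)
    also have "(LINT z|ball_law. \<phi> (vertex y (Suc i) z) - \<phi> (vertex y i z)) = m (Suc i) - m i"
      unfolding m_def by (rule Bochner_Integration.integral_diff[OF \<phi>i \<phi>i])
    finally show ?thesis .
  qed
  obtain k where k: "\<And>i. i \<ge> k \<Longrightarrow> P y i = x0 \<and> R y i = \<epsilon>" using len[OF y] by auto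
  have mk: "m i = m k" if "i \<ge> k" for i using k[OF that] k[of k] by (simp add: m_def vertex_def)
  have "(LINT l|L. f l) = (LINT i|count_space UNIV. LINT tz|(interval_law \<Otimes>\<^sub>M ball_law). f (i, tz))"
    unfolding L_def by (rule CTZ.integral_fst'[OF fi[unfolded L_def], symmetric])
  also have "\<dots> = (LINT i|count_space UNIV. m (Suc i) - m i)" by (simp only: step)
  also have "\<dots> = (\<Sum>i | i \<in> UNIV \<and> m (Suc i) - m i \<noteq> 0. m (Suc i) - m i)"
  proof (rule lebesgue_integral_count_space_finite_support)
    have "{i \<in> UNIV. m (Suc i) - m i \<noteq> 0} \<subseteq> {..<k}"
    proof
      fix i assume i: "i \<in> {i \<in> UNIV. m (Suc i) - m i \<noteq> 0}"
      show "i \<in> {..<k}"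
      proof (rule ccontr)
        assume "i \<notin> {..<k}"
        then have "m (Suc i) = m k" "m i = m k" by (intro mk; simp)+
        with i show False by simp
      qed
    qed
    then show "finite {i \<in> UNIV. m (Suc i) - m i \<noteq> 0}" by (rule finite_subset) simp
  qed
  also have "\<dots> = (\<Sum>i<k. m (Suc i) - m i)"
  proof (rule sum.mono_neutral_left)
    show "{i. i \<in> UNIV \<and> m (Suc i) - m i \<noteq> 0} \<subseteq> {..<k}"
    proof
      fix i assume i: "i \<in> {i. i \<in> UNIV \<and> m (Suc i) - m i \<noteq> 0}"
      show "i \<in> {..<k}"
      proof (rule ccontr)
        assume "i \<notin> {..<k}"
        then have "m (Suc i) = m k" "m i = m k" by (intro mk; simp)+
        with i show False by simp
      qed
    qed
  qed auto
  also have "\<dots> = m k - m 0" by (rule sum_lessThan_telescope)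
  also have "m 0 = \<phi> y"
    by (simp add: m_def vertex_def P_0 R_0 measure_def emeasure_ball_law)
  also have "m k = (LINT z|ball_law. \<phi> (x0 + \<epsilon> *\<^sub>R z))"
    using k[of k] by (simp add: m_def vertex_def)
  finally show "(LINT l|L. V (y, l) \<bullet> gradient \<phi> (X (y, l))) = (LINT z|ball_law. \<phi> (x0 + \<epsilon> *\<^sub>R z)) - \<phi> y"
    by (simp add: f_def[abs_def])
qed

text \<open>The speed \<open>|V|\<close> accumulated over all particles and times, as a measure on space.\<close>

definition flux :: "(real ^ 'n) measure" where
  "flux = distr (density Q (\<lambda>q. ennreal (norm (V q)))) borel X"

lemma flux_density:
  obtains w where "w \<in> borel_measurable borel" "integrable lborel w" "\<And>x. 0 \<le> w x"
    "flux = density lborel (\<lambda>x. ennreal (w x))"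
proof -
  have fin: "finite_measure flux"
    unfolding flux_def by (rule finite_measure_pushforward[OF measurable_X integrable_norm_V]) simp
  have sets: "sets flux = sets lborel" by (simp add: flux_def)
  have ac: "absolutely_continuous lborel flux"
    unfolding absolutely_continuous_def
  proof
    fix N :: "(real ^ 'n) set" assume N: "N \<in> null_sets lborel"
    then have [measurable]: "N \<in> sets borel" by auto
    have "emeasure flux N = (\<integral>\<^sup>+q. ennreal (norm (V q)) * indicator (X -` N \<inter> space Q) q \<partial>Q)"
      by (simp add: flux_def emeasure_distr emeasure_density)
    also have "\<dots> = 0"
    proof (subst nn_integral_0_iff_AE)
      show "AE q in Q. ennreal (norm (V q)) * indicator (X -` N \<inter> space Q) q = 0"
        using AE_X_not_in_null[OF N] by eventually_elim simp
    qed measurable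
    finally show "N \<in> null_sets flux" by (simp add: null_sets_def sets)
  qed
  obtain w where w: "w \<in> borel_measurable lborel" "AE x in lborel. RN_deriv lborel flux x = ennreal (w x)"
    "\<And>x. 0 \<le> w x"
    using sigma_finite_measure.real_RN_deriv[OF sigma_finite_lborel fin ac sets] by blast
  have wm[measurable]: "w \<in> borel_measurable borel" using w(1) by simp
  have "flux = density lborel (RN_deriv lborel flux)"
    by (rule sigma_finite_measure.density_RN_deriv[OF sigma_finite_lborel ac sets, symmetric])
  also have "\<dots> = density lborel (\<lambda>x. ennreal (w x))"
    using w(2) by (intro density_cong) auto
  finally have flux: "flux = density lborel (\<lambda>x. ennreal (w x))" .
  interpret F: finite_measure flux by (rule fin)
  have "integrable lborel w"
  proof (rule integrableI_bounded)
    have "(\<integral>\<^sup>+x. ennreal (norm (w x)) \<partial>lborel) = emeasure flux UNIV"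
      unfolding flux using w(3) by (simp add: emeasure_density)
    then show "(\<integral>\<^sup>+x. ennreal (norm (w x)) \<partial>lborel) < \<infinity>"
      using F.emeasure_finite[of UNIV, unfolded infinity_ennreal_def top.not_eq_extremum] by simp
  qed measurable
  with wm w(3) flux that show ?thesis by blast
qed

text \<open>The mean of \<open>\<phi>\<close> around \<open>x0\<close> is multiplied by the total mass of \<open>h M\<close>, which vanishes.\<close>

lemma integral_weighted_gradient:
  assumes h[measurable]: "h \<in> borel_measurable M" and hb: "\<And>y. \<bar>h y\<bar> \<le> \<kappa>" and h0: "(LINT y|M. h y) = 0"
    and \<phi>: "test_function \<phi>"
  shows "(LINT q|Q. h (fst q) * (V q \<bullet> gradient \<phi> (X q))) = - (LINT y|M. \<phi> y * h y)"
proof -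
  have k: "0 \<le> \<kappa>" using hb[of undefined] by linarith
  interpret M_L: pair_sigma_finite M L by (rule pair_M_L)
  interpret M: finite_measure M by (rule finite_M)
  have [measurable]: "gradient \<phi> \<in> borel_measurable borel" and \<phi>m: "\<phi> \<in> borel_measurable borel"
    using test_function_gradient(2,3)[OF \<phi>] by (auto intro: borel_measurable_continuous_onI)
  have [measurable]: "\<phi> \<in> borel_measurable M" by (rule measurable_M[OF \<phi>m])
  obtain B where B: "\<And>x. norm (gradient \<phi> x) \<le> B" using test_function_gradient(5)[OF \<phi>] by blast
  obtain B\<phi> where B\<phi>: "\<And>x. \<bar>\<phi> x\<bar> \<le> B\<phi>" using test_function_gradient(4)[OF \<phi>] by blast
  have hm: "(\<lambda>q. h (fst q)) \<in> borel_measurable Q"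
    unfolding Q_def by (rule measurable_compose[OF measurable_fst h])
  have int: "integrable Q (\<lambda>q. h (fst q) * (V q \<bullet> gradient \<phi> (X q)))"
  proof (rule Bochner_Integration.integrable_bound[OF integrable_mult_right[OF integrable_norm_V, of "\<kappa> * B"]])
    show "(\<lambda>q. h (fst q) * (V q \<bullet> gradient \<phi> (X q))) \<in> borel_measurable Q"
      by (intro borel_measurable_times hm) measurable
    show "AE q in Q. norm (h (fst q) * (V q \<bullet> gradient \<phi> (X q))) \<le> norm (\<kappa> * B * norm (V q))"
    proof (rule AE_I2)
      fix q
      have "\<bar>V q \<bullet> gradient \<phi> (X q)\<bar> \<le> norm (V q) * norm (gradient \<phi> (X q))"
        by (rule Cauchy_Schwarz_ineq2)
      also have "\<dots> \<le> norm (V q) * B" by (intro mult_left_mono B) simp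
      finally have "\<bar>h (fst q)\<bar> * \<bar>V q \<bullet> gradient \<phi> (X q)\<bar> \<le> \<kappa> * (norm (V q) * B)"
        using hb k by (intro mult_mono) auto
      also have "\<dots> \<le> \<bar>\<kappa> * B * norm (V q)\<bar>" by (simp add: mult.commute mult.left_commute)
      finally show "norm (h (fst q) * (V q \<bullet> gradient \<phi> (X q))) \<le> norm (\<kappa> * B * norm (V q))"
        by (simp only: real_norm_def abs_mult[of "h (fst q)"])
    qed
  qed
  define c where "c = (LINT z|ball_law. \<phi> (x0 + \<epsilon> *\<^sub>R z))"
  have hi: "integrable M h" by (rule M.integrable_const_bound[of _ \<kappa>]) (use hb in auto)
  have \<phi>hi: "integrable M (\<lambda>y. \<phi> y * h y)"
  proof (rule M.integrable_const_bound[of _ "B\<phi> * \<kappa>"])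
    show "AE y in M. norm (\<phi> y * h y) \<le> B\<phi> * \<kappa>"
    proof (rule AE_I2)
      fix y
      have "\<bar>\<phi> y\<bar> * \<bar>h y\<bar> \<le> B\<phi> * \<kappa>"
        using order_trans[OF abs_ge_zero B\<phi>] by (intro mult_mono B\<phi> hb) simp_all
      then show "norm (\<phi> y * h y) \<le> B\<phi> * \<kappa>" by (simp add: abs_mult)
    qed
  qed measurable
  have "(LINT q|Q. h (fst q) * (V q \<bullet> gradient \<phi> (X q)))
      = (LINT y|M. LINT l|L. h y * (V (y, l) \<bullet> gradient \<phi> (X (y, l))))"
    using M_L.integral_fst'[OF int[unfolded Q_def]] by (simp add: Q_def)
  also have "\<dots> = (LINT y|M. c * h y - \<phi> y * h y)"
  proof (rule Bochner_Integration.integral_cong[OF refl])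
    fix y assume "y \<in> space M"
    then have "y \<in> \<Omega>" by (simp add: space_M)
    from integral_gradient_section(2)[OF \<phi> this]
    show "(LINT l|L. h y * (V (y, l) \<bullet> gradient \<phi> (X (y, l)))) = c * h y - \<phi> y * h y"
      by (simp add: c_def right_diff_distrib mult.commute)
  qed
  also have "\<dots> = c * (LINT y|M. h y) - (LINT y|M. \<phi> y * h y)"
    using hi \<phi>hi by simp
  finally show ?thesis by (simp add: h0)
qed

text \<open>The \<open>i\<close>-th component of \<open>u\<close> is the density of the image of \<open>h V\<^sub>i Q\<close> under \<open>X\<close>: the multiplier \<open>H i\<close>
  relative to the flux, times the density \<open>w\<close> of the flux.\<close>

lemma transport_weight:
  obtains w where "w \<in> borel_measurable borel" "integrable lborel w" "\<And>x. 0 \<le> w x"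
    "\<And>h \<kappa>. h \<in> borel_measurable M \<Longrightarrow> (\<And>y. \<bar>h y\<bar> \<le> \<kappa>) \<Longrightarrow> (LINT y|M. h y) = 0 \<Longrightarrow>
      \<exists>u :: real ^ 'n \<Rightarrow> real ^ 'n. u \<in> borel_measurable borel \<and>
        (\<forall>x. norm (u x) \<le> real CARD('n) * \<kappa> * w x) \<and>
        (\<forall>\<phi>. test_function \<phi> \<longrightarrow>
          (LINT x|lborel. indicator \<Omega> x *\<^sub>R (u x \<bullet> gradient \<phi> x)) = - (LINT y|M. \<phi> y * h y))"
proof -
  obtain w where wm[measurable]: "w \<in> borel_measurable borel" and wi: "integrable lborel w"
    and w0: "\<And>x. 0 \<le> w x" and flux: "flux = density lborel (\<lambda>x. ennreal (w x))"
    using flux_density by metis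
  have "\<exists>u :: real ^ 'n \<Rightarrow> real ^ 'n. u \<in> borel_measurable borel \<and>
        (\<forall>x. norm (u x) \<le> real CARD('n) * \<kappa> * w x) \<and>
        (\<forall>\<phi>. test_function \<phi> \<longrightarrow>
          (LINT x|lborel. indicator \<Omega> x *\<^sub>R (u x \<bullet> gradient \<phi> x)) = - (LINT y|M. \<phi> y * h y))"
    if h: "h \<in> borel_measurable M" and hb: "\<And>y. \<bar>h y\<bar> \<le> \<kappa>" and h0: "(LINT y|M. h y) = 0" for h \<kappa>
  proof -
    have k: "0 \<le> \<kappa>" using hb[of undefined] by linarith
    define g where "g i q = h (fst q) * (V q \<bullet> axis i 1)" for i q
    have hm: "(\<lambda>q. h (fst q)) \<in> borel_measurable Q"
      unfolding Q_def by (rule measurable_compose[OF measurable_fst h])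
    have gm[measurable]: "g i \<in> borel_measurable Q" for i
      unfolding g_def by (intro borel_measurable_times hm) measurable
    have gb: "\<bar>g i q\<bar> \<le> \<kappa> * norm (V q)" for i q
    proof -
      have "\<bar>V q \<bullet> axis i 1\<bar> \<le> norm (V q)"
        using Cauchy_Schwarz_ineq2[of "V q" "axis i 1"] by (simp add: norm_axis_1)
      then show ?thesis unfolding g_def abs_mult using hb k by (intro mult_mono) auto
    qed
    define multiplier where "multiplier i H \<longleftrightarrow> H \<in> borel_measurable borel \<and> (\<forall>x. \<bar>H x\<bar> \<le> \<kappa>) \<and>
        (\<forall>(f :: real ^ 'n \<Rightarrow> real) B. f \<in> borel_measurable borel \<longrightarrow> (\<forall>x. \<bar>f x\<bar> \<le> B) \<longrightarrow>
          (LINT q|Q. f (X q) * g i q) = (LINT x|flux. f x * H x))" for i H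
    have "\<exists>H. multiplier i H" for i
    proof -
      obtain H where "H \<in> borel_measurable borel" "\<And>x. \<bar>H x\<bar> \<le> \<kappa>"
        "\<And>(f :: real ^ 'n \<Rightarrow> real) B. f \<in> borel_measurable borel \<Longrightarrow> (\<And>x. \<bar>f x\<bar> \<le> B) \<Longrightarrow>
          (LINT q|Q. f (X q) * g i q) = (LINT x|flux. f x * H x)"
        unfolding flux_def
        by (rule pushforward_multiplier[OF measurable_X integrable_norm_V norm_ge_zero gm[of i] gb[of i] k]) blast
      then show ?thesis unfolding multiplier_def by blast
    qed
    then obtain H where "\<And>i. multiplier i (H i)" by metis
    then have Hm[measurable]: "\<And>i. H i \<in> borel_measurable borel" and Hb: "\<And>i x. \<bar>H i x\<bar> \<le> \<kappa>"
      and H: "\<And>i (f :: real ^ 'n \<Rightarrow> real) B. f \<in> borel_measurable borel \<Longrightarrow> (\<And>x. \<bar>f x\<bar> \<le> B) \<Longrightarrow>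
          (LINT q|Q. f (X q) * g i q) = (LINT x|flux. f x * H i x)"
      unfolding multiplier_def by blast+
    define u :: "real ^ 'n \<Rightarrow> real ^ 'n" where "u x = (\<Sum>i\<in>UNIV. (H i x * w x) *\<^sub>R axis i 1)" for x
    have um: "u \<in> borel_measurable borel" unfolding u_def by measurable
    have ub: "norm (u x) \<le> real CARD('n) * \<kappa> * w x" for x
    proof -
      have "norm (u x) \<le> (\<Sum>i\<in>(UNIV :: 'n set). \<kappa> * w x)"
        unfolding u_def
      proof (rule sum_norm_le)
        fix i show "norm ((H i x * w x) *\<^sub>R (axis i 1 :: real ^ 'n)) \<le> \<kappa> * w x"
          using mult_right_mono[OF Hb[of i x] w0[of x]] w0[of x] by (simp add: norm_axis_1 abs_mult)
      qed
      then show ?thesis by simp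
    qed
    have "(LINT x|lborel. indicator \<Omega> x *\<^sub>R (u x \<bullet> gradient \<phi> x)) = - (LINT y|M. \<phi> y * h y)"
      if \<phi>: "test_function \<phi>" for \<phi>
    proof -
      have [measurable]: "gradient \<phi> \<in> borel_measurable borel"
        using test_function_gradient(3)[OF \<phi>] by (auto intro: borel_measurable_continuous_onI)
      have [measurable]: "\<Omega> \<in> sets borel" using open_\<Omega> by simp
      obtain B where B: "\<And>x. norm (gradient \<phi> x) \<le> B" using test_function_gradient(5)[OF \<phi>] by blast
      have B0: "0 \<le> B" using order_trans[OF norm_ge_zero B] .
      \<comment> \<open>The indicator is free on the side of \<open>Q\<close>, where \<open>X\<close> lies in \<open>\<Omega>\<close> almost surely, and it confines the Lebesgue integral to \<open>\<Omega>\<close>.\<close>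
      define f where "f i x = indicator \<Omega> x * (gradient \<phi> x \<bullet> axis i 1)" for i x
      have fm[measurable]: "f i \<in> borel_measurable borel" for i unfolding f_def by measurable
      have fb: "\<bar>f i x\<bar> \<le> B" for i x
      proof -
        have "\<bar>gradient \<phi> x \<bullet> axis i 1\<bar> \<le> B"
          using Cauchy_Schwarz_ineq2[of "gradient \<phi> x" "axis i 1"] B[of x] by (simp add: norm_axis_1)
        then show ?thesis using B0 by (simp add: f_def indicator_def)
      qed
      have expand: "v \<bullet> v' = (\<Sum>i\<in>UNIV. (v \<bullet> axis i 1) * (v' \<bullet> axis i 1))" for v v' :: "real ^ 'n"
      proof -
        have "c \<bullet> axis i 1 = c $ i" for c :: "real ^ 'n" and i by (simp add: inner_axis)
        then show ?thesis by (simp add: inner_vec_def[of v v'])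
      qed
      have intL: "integrable lborel (\<lambda>x. w x * (f i x * H i x))" for i
      proof (rule Bochner_Integration.integrable_bound[OF integrable_mult_right[OF wi, of "B * \<kappa>"]])
        show "AE x in lborel. norm (w x * (f i x * H i x)) \<le> norm (B * \<kappa> * w x)"
        proof (rule AE_I2)
          fix x
          have "\<bar>f i x\<bar> * \<bar>H i x\<bar> \<le> B * \<kappa>" using fb Hb B0 by (intro mult_mono) auto
          then have "w x * (\<bar>f i x\<bar> * \<bar>H i x\<bar>) \<le> w x * (B * \<kappa>)" by (rule mult_left_mono[OF _ w0])
          then show "norm (w x * (f i x * H i x)) \<le> norm (B * \<kappa> * w x)"
            using w0[of x] B0 k by (simp add: abs_mult mult.commute)
        qed
      qed measurable
      have intQ: "integrable Q (\<lambda>q. f i (X q) * g i q)" for i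
      proof (rule Bochner_Integration.integrable_bound[OF integrable_mult_right[OF integrable_norm_V, of "B * \<kappa>"]])
        show "AE q in Q. norm (f i (X q) * g i q) \<le> norm (B * \<kappa> * norm (V q))"
        proof (rule AE_I2)
          fix q
          have "\<bar>f i (X q)\<bar> * \<bar>g i q\<bar> \<le> B * (\<kappa> * norm (V q))"
            using fb gb B0 by (intro mult_mono) auto
          then show "norm (f i (X q) * g i q) \<le> norm (B * \<kappa> * norm (V q))"
            using B0 k by (simp add: abs_mult mult.assoc)
        qed
      qed measurable
      have "(LINT x|lborel. indicator \<Omega> x *\<^sub>R (u x \<bullet> gradient \<phi> x))
          = (LINT x|lborel. (\<Sum>i\<in>UNIV. w x * (f i x * H i x)))"
      proof (intro Bochner_Integration.integral_cong refl)
        fix x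
        have "indicator \<Omega> x *\<^sub>R (u x \<bullet> gradient \<phi> x)
            = (\<Sum>i\<in>UNIV. indicator \<Omega> x * ((H i x * w x) * (axis i 1 \<bullet> gradient \<phi> x)))"
          by (simp add: u_def inner_sum_left sum_distrib_left)
        also have "\<dots> = (\<Sum>i\<in>UNIV. w x * (f i x * H i x))"
          by (intro sum.cong refl) (simp add: f_def inner_commute[of "gradient \<phi> x"])
        finally show "indicator \<Omega> x *\<^sub>R (u x \<bullet> gradient \<phi> x) = (\<Sum>i\<in>UNIV. w x * (f i x * H i x))" .
      qed
      also have "\<dots> = (\<Sum>i\<in>UNIV. LINT x|lborel. w x * (f i x * H i x))"
        by (rule Bochner_Integration.integral_sum) (rule intL)
      also have "\<dots> = (\<Sum>i\<in>UNIV. LINT x|flux. f i x * H i x)"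
      proof (intro sum.cong refl)
        fix i
        show "(LINT x|lborel. w x * (f i x * H i x)) = (LINT x|flux. f i x * H i x)"
          unfolding flux by (subst integral_density) (simp_all add: w0)
      qed
      also have "\<dots> = (\<Sum>i\<in>UNIV. LINT q|Q. f i (X q) * g i q)"
        by (intro sum.cong refl) (rule H[OF fm fb, symmetric])
      also have "\<dots> = (LINT q|Q. (\<Sum>i\<in>UNIV. f i (X q) * g i q))"
        by (rule Bochner_Integration.integral_sum[symmetric]) (rule intQ)
      also have "\<dots> = (LINT q|Q. h (fst q) * (V q \<bullet> gradient \<phi> (X q)))"
      proof (rule integral_cong_AE)
        show "AE q in Q. (\<Sum>i\<in>UNIV. f i (X q) * g i q) = h (fst q) * (V q \<bullet> gradient \<phi> (X q))"
          using AE_X_in_\<Omega>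
        proof eventually_elim
          case (elim q)
          have "h (fst q) * (V q \<bullet> gradient \<phi> (X q))
              = (\<Sum>i\<in>UNIV. h (fst q) * ((V q \<bullet> axis i 1) * (gradient \<phi> (X q) \<bullet> axis i 1)))"
            by (subst expand) (rule sum_distrib_left)
          also have "\<dots> = (\<Sum>i\<in>UNIV. f i (X q) * g i q)"
            using elim by (intro sum.cong refl) (simp add: f_def g_def)
          finally show ?case by (rule sym)
        qed
        show "(\<lambda>q. h (fst q) * (V q \<bullet> gradient \<phi> (X q))) \<in> borel_measurable Q"
          by (intro borel_measurable_times hm) measurable
      qed measurable
      also have "\<dots> = - (LINT y|M. \<phi> y * h y)"
        by (rule integral_weighted_gradient[OF h hb h0 \<phi>])
      finally show ?thesis .
    qed
    with um ub show ?thesis by blast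
  qed
  with wm wi w0 that show ?thesis by blast
qed

end

section \<open>The weighted divergence equation\<close>

text \<open>A positive distance to a nonempty complement means lying outside the closure of the complement.\<close>

lemma cover_core_eq_interior:
  assumes "- T \<noteq> {}"
  shows "cover_core T = interior T"
proof -
  have "x \<in> T \<and> infdist x (- T) > 0 \<longleftrightarrow> x \<notin> closure (- T)" for x
  proof -
    have "x \<notin> closure (- T) \<Longrightarrow> x \<in> T" using closure_subset[of "- T"] by auto
    then show ?thesis
      using in_closure_iff_infdist_zero[OF assms, of x] infdist_nonneg[of x "- T"] by auto
  qed
  then show ?thesis unfolding cover_core_def interior_closure by auto
qed

theorem theorem1p3:
  fixes \<Omega> \<Omega>t :: "(real ^ 'n) set" and x0 :: "real ^ 'n"
  assumes "open \<Omega>" and "connected \<Omega>" and "bounded \<Omega>"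
    and "\<Omega>t \<in> sets lebesgue" and "\<Omega> \<subseteq> \<Omega>t" and "emeasure lebesgue (\<Omega>t - \<Omega>) = 0"
    and "x0 \<in> \<Omega>"
  shows "\<exists>C::real. C > 0 \<and>
    (\<forall>\<mu>0. radon_measure_in \<Omega> \<mu>0 \<and> finite_measure \<mu>0 \<and> emeasure \<mu>0 \<Omega> \<noteq> 0 \<and>
           integrable \<mu>0 (inner_dist (cover_core \<Omega>t) x0) \<longrightarrow>
      (\<exists>w0 :: real ^ 'n \<Rightarrow> real.
         w0 \<in> borel_measurable (lebesgue_on \<Omega>) \<and>
         integrable (lebesgue_on \<Omega>) w0 \<and>
         (AE x in lebesgue_on \<Omega>. w0 x > 0) \<and>
         (\<forall>(\<mu> :: (real ^ 'n) set \<Rightarrow> real) (\<kappa> :: real).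
            finite_signed_radon_measure_in \<Omega> \<mu> \<and> \<mu> \<Omega> = 0 \<and> \<kappa> > 0 \<and>
            (\<forall>A \<in> borel_in \<Omega>. emeasure (variation_measure \<Omega> \<mu>) A \<le> ennreal \<kappa> * emeasure \<mu>0 A) \<longrightarrow>
            (\<exists>u :: real ^ 'n \<Rightarrow> real ^ 'n.
               u \<in> borel_measurable (lebesgue_on \<Omega>) \<and>
               (AE x in lebesgue_on \<Omega>. norm (u x) \<le> C * \<kappa> * \<bar>w0 x\<bar>) \<and>
               (\<forall>\<phi>. test_function \<phi> \<longrightarrow>
                  (LINT x|lebesgue_on \<Omega>. u x \<bullet> gradient \<phi> x) = - signed_integral \<Omega> \<mu> \<phi>)))))"
proof -
  define S where "S = cover_core \<Omega>t"
  have \<Omega>m: "\<Omega> \<in> sets borel" using assms(1) by simp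
  have fin\<Omega>: "emeasure lborel \<Omega> < \<infinity>" using emeasure_bounded_finite[OF assms(3)] .
  \<comment> \<open>A measurable cover of a bounded set has finite measure.\<close>
  have "- \<Omega>t \<noteq> {}"
  proof
    assume "- \<Omega>t = {}"
    then have "\<Omega>t = UNIV" by auto
    then have null: "- \<Omega> \<in> null_sets lebesgue"
      using assms(6) \<Omega>m by (auto simp: null_sets_def Compl_eq_Diff_UNIV)
    have "emeasure lborel (UNIV :: (real ^ 'n) set) = emeasure lborel (\<Omega> \<union> - \<Omega>)" by simp
    also have "\<dots> \<le> emeasure lborel \<Omega> + emeasure lborel (- \<Omega>)"
      using \<Omega>m by (intro emeasure_subadditive) auto
    also have "\<dots> < \<infinity>" using fin\<Omega> null \<Omega>m by (simp add: null_sets_def)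
    finally show False by simp
  qed
  then have S_int: "S = interior \<Omega>t" unfolding S_def by (rule cover_core_eq_interior)
  have openS: "open S" by (simp add: S_int)
  have \<Omega>S: "\<Omega> \<subseteq> S" unfolding S_int using assms(1,5) by (simp add: interior_maximal)
  have "S - \<Omega> \<in> null_sets lebesgue"
  proof (rule null_sets_subset)
    show "\<Omega>t - \<Omega> \<in> null_sets lebesgue" using assms(4,6) \<Omega>m by (auto simp: null_sets_def)
    show "S - \<Omega> \<in> sets lebesgue" using openS \<Omega>m by auto
    show "S - \<Omega> \<subseteq> \<Omega>t - \<Omega>" unfolding S_int using interior_subset[of \<Omega>t] by auto
  qed
  then have "S - \<Omega> \<in> null_sets lborel" using openS \<Omega>m by (simp add: null_sets_def)
  then have AE_S: "AE x in lborel. x \<in> S \<longrightarrow> x \<in> \<Omega>" by (rule AE_I') auto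
  obtain P :: "real ^ 'n \<Rightarrow> nat \<Rightarrow> real ^ 'n" and R :: "real ^ 'n \<Rightarrow> nat \<Rightarrow> real" and \<epsilon> :: real
    where chains: "\<And>i. (\<lambda>y. P y i) \<in> borel_measurable borel" "\<And>i. (\<lambda>y. R y i) \<in> borel_measurable borel"
      "\<And>y. P y 0 = y" "\<And>y. R y 0 = 0" "\<And>y i. 0 < R y (Suc i)"
      "\<And>y i z. y \<in> \<Omega> \<Longrightarrow> norm z < 1 \<Longrightarrow>
         closed_segment (P y i + R y i *\<^sub>R z) (P y (Suc i) + R y (Suc i) *\<^sub>R z) \<subseteq> S"
      "\<And>y. y \<in> \<Omega> \<Longrightarrow> \<exists>k. (\<forall>i\<ge>k. P y i = x0 \<and> R y i = \<epsilon>) \<and>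
         (\<Sum>i<k. dist (P y i) (P y (Suc i)) + \<bar>R y (Suc i) - R y i\<bar>) \<le> inner_dist S x0 y + 5"
    by (rule fattened_polygons[OF openS assms(1,2) \<Omega>S assms(7)]) blast
  show ?thesis
  proof (intro exI[of _ "real CARD('n)"] conjI allI impI)
    show "0 < real CARD('n)" by simp
    fix \<mu>0 :: "(real ^ 'n) measure"
    assume "radon_measure_in \<Omega> \<mu>0 \<and> finite_measure \<mu>0 \<and> emeasure \<mu>0 \<Omega> \<noteq> 0 \<and>
      integrable \<mu>0 (inner_dist (cover_core \<Omega>t) x0)"
    then have sM: "sets \<mu>0 = borel_in \<Omega>" and fM: "finite_measure \<mu>0" and d: "integrable \<mu>0 (inner_dist S x0)"
      by (auto simp: radon_measure_in_def S_def)
    interpret \<mu>0: finite_measure \<mu>0 by (rule fM)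
    have T: "fattened_transport \<mu>0 \<Omega> S x0 \<epsilon> P R (\<lambda>y. inner_dist S x0 y + 5)"
      by unfold_locales (use chains sM fM openS assms(1) AE_S d in auto)
    obtain w where wm: "w \<in> borel_measurable borel" and wi: "integrable lborel w" and w0: "\<And>x. 0 \<le> w x"
      and w: "\<And>h \<kappa>. h \<in> borel_measurable \<mu>0 \<Longrightarrow> (\<And>y. \<bar>h y\<bar> \<le> \<kappa>) \<Longrightarrow> (LINT y|\<mu>0. h y) = 0 \<Longrightarrow>
        \<exists>u :: real ^ 'n \<Rightarrow> real ^ 'n. u \<in> borel_measurable borel \<and>
          (\<forall>x. norm (u x) \<le> real CARD('n) * \<kappa> * w x) \<and>
          (\<forall>\<phi>. test_function \<phi> \<longrightarrow>
            (LINT x|lborel. indicator \<Omega> x *\<^sub>R (u x \<bullet> gradient \<phi> x)) = - (LINT y|\<mu>0. \<phi> y * h y))"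
      by (rule fattened_transport.transport_weight[OF T]) blast
    have on_\<Omega>: "f \<in> borel_measurable (lebesgue_on \<Omega>)" if "f \<in> borel_measurable borel"
      for f :: "real ^ 'n \<Rightarrow> 'b::topological_space"
      using that by (intro measurable_restrict_space1 measurable_completion) simp
    \<comment> \<open>Adding \<open>1\<close> gives positivity where no particle passes; it is integrable since \<open>\<Omega>\<close> is bounded.\<close>
    define w0' where "w0' x = w x + 1" for x
    show "\<exists>w0 :: real ^ 'n \<Rightarrow> real.
         w0 \<in> borel_measurable (lebesgue_on \<Omega>) \<and>
         integrable (lebesgue_on \<Omega>) w0 \<and>
         (AE x in lebesgue_on \<Omega>. w0 x > 0) \<and>
         (\<forall>(\<mu> :: (real ^ 'n) set \<Rightarrow> real) (\<kappa> :: real).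
            finite_signed_radon_measure_in \<Omega> \<mu> \<and> \<mu> \<Omega> = 0 \<and> \<kappa> > 0 \<and>
            (\<forall>A \<in> borel_in \<Omega>. emeasure (variation_measure \<Omega> \<mu>) A \<le> ennreal \<kappa> * emeasure \<mu>0 A) \<longrightarrow>
            (\<exists>u :: real ^ 'n \<Rightarrow> real ^ 'n.
               u \<in> borel_measurable (lebesgue_on \<Omega>) \<and>
               (AE x in lebesgue_on \<Omega>. norm (u x) \<le> real CARD('n) * \<kappa> * \<bar>w0 x\<bar>) \<and>
               (\<forall>\<phi>. test_function \<phi> \<longrightarrow>
                  (LINT x|lebesgue_on \<Omega>. u x \<bullet> gradient \<phi> x) = - signed_integral \<Omega> \<mu> \<phi>)))"
    proof (intro exI[of _ w0'] conjI allI impI)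
      show "w0' \<in> borel_measurable (lebesgue_on \<Omega>)"
        unfolding w0'_def by (intro on_\<Omega> borel_measurable_add wm borel_measurable_const)
      have "integrable lborel (\<lambda>x. indicator \<Omega> x *\<^sub>R w x)"
        by (rule integrable_mult_indicator[OF _ wi]) (simp add: \<Omega>m)
      moreover have "integrable lborel (indicator \<Omega> :: _ \<Rightarrow> real)"
        using \<Omega>m fin\<Omega> by (intro integrable_real_indicator) simp_all
      ultimately have "integrable lborel (\<lambda>x. indicator \<Omega> x *\<^sub>R w x + indicator \<Omega> x)"
        by (rule Bochner_Integration.integrable_add)
      then have "integrable lebesgue (\<lambda>x. indicator \<Omega> x *\<^sub>R w0' x)"
        using wm \<Omega>m by (subst integrable_completion) (auto simp: w0'_def algebra_simps)
      then show "integrable (lebesgue_on \<Omega>) w0'"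
        using \<Omega>m by (subst integrable_restrict_space) auto
      show "AE x in lebesgue_on \<Omega>. w0' x > 0"
        using w0 by (intro AE_I2) (simp add: w0'_def add_nonneg_pos)
      fix \<mu> :: "(real ^ 'n) set \<Rightarrow> real" and \<kappa> :: real
      assume A: "finite_signed_radon_measure_in \<Omega> \<mu> \<and> \<mu> \<Omega> = 0 \<and> \<kappa> > 0 \<and>
        (\<forall>A \<in> borel_in \<Omega>. emeasure (variation_measure \<Omega> \<mu>) A \<le> ennreal \<kappa> * emeasure \<mu>0 A)"
      then have mu: "finite_signed_measure_in \<Omega> \<mu>" and mu0: "\<mu> \<Omega> = 0" and k: "0 \<le> \<kappa>"
        and le: "\<And>A. A \<in> borel_in \<Omega> \<Longrightarrow> emeasure (variation_measure \<Omega> \<mu>) A \<le> ennreal \<kappa> * emeasure \<mu>0 A"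
        by (auto simp: finite_signed_radon_measure_in_def)
      obtain h where hm: "h \<in> borel_measurable \<mu>0" and hb: "\<And>x. \<bar>h x\<bar> \<le> \<kappa>"
        and rep: "\<And>f B. f \<in> borel_measurable \<mu>0 \<Longrightarrow> (\<And>x. x \<in> \<Omega> \<Longrightarrow> \<bar>f x\<bar> \<le> B) \<Longrightarrow>
          signed_integral \<Omega> \<mu> f = (LINT x|\<mu>0. f x * h x)"
        and tot: "\<mu> \<Omega> = (LINT x|\<mu>0. h x)"
        by (rule signed_measure_density[OF sM fM mu k le]) blast+
      obtain u :: "real ^ 'n \<Rightarrow> real ^ 'n" where um: "u \<in> borel_measurable borel"
        and ub: "\<And>x. norm (u x) \<le> real CARD('n) * \<kappa> * w x"
        and div: "\<And>\<phi>. test_function \<phi> \<Longrightarrow>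
            (LINT x|lborel. indicator \<Omega> x *\<^sub>R (u x \<bullet> gradient \<phi> x)) = - (LINT y|\<mu>0. \<phi> y * h y)"
        using w[OF hm hb] tot mu0 by auto
      show "\<exists>u :: real ^ 'n \<Rightarrow> real ^ 'n.
               u \<in> borel_measurable (lebesgue_on \<Omega>) \<and>
               (AE x in lebesgue_on \<Omega>. norm (u x) \<le> real CARD('n) * \<kappa> * \<bar>w0' x\<bar>) \<and>
               (\<forall>\<phi>. test_function \<phi> \<longrightarrow>
                  (LINT x|lebesgue_on \<Omega>. u x \<bullet> gradient \<phi> x) = - signed_integral \<Omega> \<mu> \<phi>)"
      proof (intro exI[of _ u] conjI allI impI)
        show "u \<in> borel_measurable (lebesgue_on \<Omega>)" by (rule on_\<Omega>[OF um])
        have "norm (u x) \<le> real CARD('n) * \<kappa> * \<bar>w0' x\<bar>" for x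
        proof -
          have "real CARD('n) * \<kappa> * w x \<le> real CARD('n) * \<kappa> * \<bar>w0' x\<bar>"
            using k w0[of x] by (intro mult_left_mono) (auto simp: w0'_def)
          with ub[of x] show ?thesis by linarith
        qed
        then show "AE x in lebesgue_on \<Omega>. norm (u x) \<le> real CARD('n) * \<kappa> * \<bar>w0' x\<bar>" by simp
        fix \<phi> :: "real ^ 'n \<Rightarrow> real" assume \<phi>: "test_function \<phi>"
        note [measurable] = \<Omega>m um
        have gm[measurable]: "gradient \<phi> \<in> borel_measurable borel" and \<phi>m: "\<phi> \<in> borel_measurable borel"
          using test_function_gradient(2,3)[OF \<phi>] by (auto intro: borel_measurable_continuous_onI)
        obtain B where B: "\<And>x. \<bar>\<phi> x\<bar> \<le> B" using test_function_gradient(4)[OF \<phi>] by blast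
        have "(LINT x|lebesgue_on \<Omega>. u x \<bullet> gradient \<phi> x)
            = (LINT x|lebesgue. indicator \<Omega> x *\<^sub>R (u x \<bullet> gradient \<phi> x))"
          using \<Omega>m by (subst integral_restrict_space) auto
        also have "\<dots> = (LINT x|lborel. indicator \<Omega> x *\<^sub>R (u x \<bullet> gradient \<phi> x))"
          by (rule integral_completion) measurable
        also have "\<dots> = - (LINT y|\<mu>0. \<phi> y * h y)" by (rule div[OF \<phi>])
        also have "(LINT y|\<mu>0. \<phi> y * h y) = signed_integral \<Omega> \<mu> \<phi>"
          by (rule rep[symmetric, of _ B]) (use fattened_transport.measurable_M[OF T \<phi>m] B in auto)
        finally show "(LINT x|lebesgue_on \<Omega>. u x \<bullet> gradient \<phi> x) = - signed_integral \<Omega> \<mu> \<phi>" .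
      qed
    qed
  qed
qed

end
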